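(* Let $M$ be a non-zero $(\mathcal{D},\mathcal{C})$-bicomodule. Then $\tau_M^{f.i.}=\{\mathcal{X}_L\mid L\in\mathcal{L}_{f.i.}(M)\}$ is a topology on $\mathrm{CPSpec}(M)$, i.e. $\mathbf{Z}_M^{f.i.}:=(\mathrm{CPSpec}(M),\tau_M^{f.i.})$ is a topological space. In particular, if $M$ is duo, then $M$ is a top $(\mathcal{D},\mathcal{C})$-bicomodule, i.e. $\mathbf{Z}_M:=(\mathrm{CPSpec}(M),\tau_M)$ is a topological space, where $\tau_M=\{\mathcal{X}_L\mid L\in\mathcal{L}(M)\}$.
   Context: Throughout, $R$ is a commutative ring with $1_R\neq 0_R$, $A,B$ are (unital) $R$-algebras, $\mathcal{C}$ is a non-zero $A$-coring (coassociative counital coalgebra object in $(A,A)$-bimodules) with ${}_A\mathcal{C}$ flat, and $\mathcal{D}$ is a non-zero $B$-coring with $\mathcal{D}_B$ flat. A $(\mathcal{D},\mathcal{C})$-bicomodule is a $(B,A)$-bimodule $M$ with a right $\mathcal{C}$-comodule structure $M\to M\otimes_A\mathcal{C}$ and a left $\mathcal{D}$-comodule structure $M\to\mathcal{D}\otimes_B M$, both $(B,A)$-bilinear and compatible with each other; the category ${}^{\mathcal{D}}\mathbb{M}^{\mathcal{C}}$ of these is a Grothendieck category. For a $(\mathcal{D},\mathcal{C})$-bicomodule $M$, let $E:={}^{\mathcal{D}}\mathrm{End}^{\mathcal{C}}(M)^{op}$ be the ring of $(\mathcal{D},\mathcal{C})$-bicolinear endomorphisms with opposite composition as multiplication. $\mathcal{L}(M)$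 is the lattice of $(\mathcal{D},\mathcal{C})$-subbicomodules of $M$. A subbicomodule $L\subseteq M$ is fully invariant iff $f(L)\subseteq L$ for all $f\in E$; $\mathcal{L}_{f.i.}(M)$ is the set of fully invariant subbicomodules. $M$ is duo iff every $(\mathcal{D},\mathcal{C})$-subbicomodule of $M$ is fully invariant. For $X\subseteq M$ put $\mathrm{An}(X)=\{f\in E\mid f(X)=0\}$, and for $X,Y\subseteq M$ put $(X:_M Y):=\bigcap_{f\in\mathrm{An}(X)}f^{-1}(Y)$. A non-zero fully invariant subbicomodule $K\subseteq M$ is fully $M$-coprime iff for all fully invariant subbicomodules $X,Y\subseteq M$ with $K\subseteq(X:_M Y)$ one has $K\subseteq X$ or $K\subseteq Y$. $\mathrm{CPSpec}(M)$ is the set of all fully $M$-coprime subbicomodules of $M$. For $L\in\mathcal{L}(M)$: $\mathcal{V}_L:=\{K\in\mathrm{CPSpec}(M)\mid K\subseteq L\}$ and $\mathcal{X}_L:=\{K\in\mathrm{CPSpec}(M)\mid K\nsubseteq L\}$. $M$ is called a top bicomodule iff $\xi(M):=\{\mathcal{V}_L\mid L\in\mathcal{L}(M)\}$ is closed under finite unions (equivalently, iff $\tau_M$ is a topology). *)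

theory Defs
  imports
    "HOL-Analysis.Abstract_Topology"
    "HOL-Algebra.Free_Abelian_Groups"
    "HOL-Algebra.Module"
begin

section \<open>Algebras, one-sided modules and bimodules\<close>

text \<open>The library locale \<open>algebra\<close> only covers commutative algebras.\<close>

locale unital_algebra = Module.module R A + ring A
  for R :: "('r, 'i) ring_scheme" (structure) and A :: "('r, 'a, 'j) module_scheme" (structure) +
  assumes smult_mult_left:
      "\<lbrakk>r \<in> carrier R; a \<in> carrier A; b \<in> carrier A\<rbrakk> \<Longrightarrow>
        (r \<odot>\<^bsub>A\<^esub> a) \<otimes>\<^bsub>A\<^esub> b = r \<odot>\<^bsub>A\<^esub> (a \<otimes>\<^bsub>A\<^esub> b)"
    and smult_mult_right:
      "\<lbrakk>r \<in> carrier R; a \<in> carrier A; b \<in> carrier A\<rbrakk> \<Longrightarrow>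
        a \<otimes>\<^bsub>A\<^esub> (r \<odot>\<^bsub>A\<^esub> b) = r \<odot>\<^bsub>A\<^esub> (a \<otimes>\<^bsub>A\<^esub> b)"

text \<open>As in the library record \<open>module\<close>, the ring fields \<open>mult\<close> and \<open>one\<close> of a module are
  never used.  The left action is \<open>smult\<close>, the right action \<open>rsmult\<close>; one-sided modules are
  records of the same type in which the other action is ignored.\<close>

record ('b, 'm, 'a) bimodule = "('b, 'm) module" +
  rsmult :: "'m \<Rightarrow> 'a \<Rightarrow> 'm" (infixl \<open>\<triangleleft>\<index>\<close> 70)

locale left_module = A: ring A + M: abelian_group M
  for A :: "('a, 'i) ring_scheme" and M :: "('a, 'm, 'j) module_scheme" +
  assumes l_closed: "\<lbrakk>a \<in> carrier A; x \<in> carrier M\<rbrakk> \<Longrightarrow> a \<odot>\<^bsub>M\<^esub> x \<in> carrier M"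
    and l_distr_scalar: "\<lbrakk>a \<in> carrier A; b \<in> carrier A; x \<in> carrier M\<rbrakk> \<Longrightarrow>
      (a \<oplus>\<^bsub>A\<^esub> b) \<odot>\<^bsub>M\<^esub> x = a \<odot>\<^bsub>M\<^esub> x \<oplus>\<^bsub>M\<^esub> b \<odot>\<^bsub>M\<^esub> x"
    and l_distr_vector: "\<lbrakk>a \<in> carrier A; x \<in> carrier M; y \<in> carrier M\<rbrakk> \<Longrightarrow>
      a \<odot>\<^bsub>M\<^esub> (x \<oplus>\<^bsub>M\<^esub> y) = a \<odot>\<^bsub>M\<^esub> x \<oplus>\<^bsub>M\<^esub> a \<odot>\<^bsub>M\<^esub> y"
    and l_assoc: "\<lbrakk>a \<in> carrier A; b \<in> carrier A; x \<in> carrier M\<rbrakk> \<Longrightarrow>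
      (a \<otimes>\<^bsub>A\<^esub> b) \<odot>\<^bsub>M\<^esub> x = a \<odot>\<^bsub>M\<^esub> (b \<odot>\<^bsub>M\<^esub> x)"
    and l_unit: "x \<in> carrier M \<Longrightarrow> \<one>\<^bsub>A\<^esub> \<odot>\<^bsub>M\<^esub> x = x"

locale right_module = A: ring A + M: abelian_group M
  for A :: "('a, 'i) ring_scheme" and M :: "('b, 'm, 'a, 'j) bimodule_scheme" +
  assumes r_closed: "\<lbrakk>a \<in> carrier A; x \<in> carrier M\<rbrakk> \<Longrightarrow> x \<triangleleft>\<^bsub>M\<^esub> a \<in> carrier M"
    and r_distr_scalar: "\<lbrakk>a \<in> carrier A; b \<in> carrier A; x \<in> carrier M\<rbrakk> \<Longrightarrow>
      x \<triangleleft>\<^bsub>M\<^esub> (a \<oplus>\<^bsub>A\<^esub> b) = x \<triangleleft>\<^bsub>M\<^esub> a \<oplus>\<^bsub>M\<^esub> x \<triangleleft>\<^bsub>M\<^esub> b"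
    and r_distr_vector: "\<lbrakk>a \<in> carrier A; x \<in> carrier M; y \<in> carrier M\<rbrakk> \<Longrightarrow>
      (x \<oplus>\<^bsub>M\<^esub> y) \<triangleleft>\<^bsub>M\<^esub> a = x \<triangleleft>\<^bsub>M\<^esub> a \<oplus>\<^bsub>M\<^esub> y \<triangleleft>\<^bsub>M\<^esub> a"
    and r_assoc: "\<lbrakk>a \<in> carrier A; b \<in> carrier A; x \<in> carrier M\<rbrakk> \<Longrightarrow>
      x \<triangleleft>\<^bsub>M\<^esub> (a \<otimes>\<^bsub>A\<^esub> b) = (x \<triangleleft>\<^bsub>M\<^esub> a) \<triangleleft>\<^bsub>M\<^esub> b"
    and r_unit: "x \<in> carrier M \<Longrightarrow> x \<triangleleft>\<^bsub>M\<^esub> \<one>\<^bsub>A\<^esub> = x"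

text \<open>Bimodules over \<open>R\<close>-algebras: the two induced \<open>R\<close>-actions coincide (which is automatic
  if \<open>R\<close> is the ring of integers).\<close>

locale bimodule =
  alg_B: unital_algebra R B + alg_A: unital_algebra R A + left: left_module B M + right: right_module A M
  for R :: "('r, 'i) ring_scheme" and B :: "('r, 'b, 'j) module_scheme"
    and A :: "('r, 'a, 'k) module_scheme" and M :: "('b, 'm, 'a, 'l) bimodule_scheme" +
  assumes actions_commute: "\<lbrakk>b \<in> carrier B; x \<in> carrier M; a \<in> carrier A\<rbrakk> \<Longrightarrow>
      (b \<odot>\<^bsub>M\<^esub> x) \<triangleleft>\<^bsub>M\<^esub> a = b \<odot>\<^bsub>M\<^esub> (x \<triangleleft>\<^bsub>M\<^esub> a)"
    and central: "\<lbrakk>r \<in> carrier R; x \<in> carrier M\<rbrakk> \<Longrightarrow>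
      (r \<odot>\<^bsub>B\<^esub> \<one>\<^bsub>B\<^esub>) \<odot>\<^bsub>M\<^esub> x = x \<triangleleft>\<^bsub>M\<^esub> (r \<odot>\<^bsub>A\<^esub> \<one>\<^bsub>A\<^esub>)"

definition left_linear ::
  "('a, 'i) ring_scheme \<Rightarrow> ('a, 'm, 'j) module_scheme \<Rightarrow> ('a, 'n, 'k) module_scheme \<Rightarrow> ('m \<Rightarrow> 'n) set"
  where "left_linear A M N = {f \<in> hom (add_monoid M) (add_monoid N).
    \<forall>a\<in>carrier A. \<forall>x\<in>carrier M. f (a \<odot>\<^bsub>M\<^esub> x) = a \<odot>\<^bsub>N\<^esub> f x}"

definition right_linear ::
  "('a, 'i) ring_scheme \<Rightarrow> ('b, 'm, 'a, 'j) bimodule_scheme \<Rightarrow> ('b', 'n, 'a, 'k) bimodule_scheme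
    \<Rightarrow> ('m \<Rightarrow> 'n) set"
  where "right_linear A M N = {f \<in> hom (add_monoid M) (add_monoid N).
    \<forall>a\<in>carrier A. \<forall>x\<in>carrier M. f (x \<triangleleft>\<^bsub>M\<^esub> a) = f x \<triangleleft>\<^bsub>N\<^esub> a}"

definition bilinear ::
  "('b, 'h) ring_scheme \<Rightarrow> ('a, 'i) ring_scheme \<Rightarrow> ('b, 'm, 'a, 'j) bimodule_scheme
    \<Rightarrow> ('b, 'n, 'a, 'k) bimodule_scheme \<Rightarrow> ('m \<Rightarrow> 'n) set"
  where "bilinear B A M N = left_linear B M N \<inter> right_linear A M N"

definition regular_bimodule :: "('a, 'i) ring_scheme \<Rightarrow> ('a, 'a, 'a) bimodule"
  where "regular_bimodule A = \<lparr>carrier = carrier A, mult = mult A, one = one A, zero = zero A,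
    add = add A, smult = mult A, rsmult = mult A\<rparr>"


section \<open>Tensor products over a non-commutative ring\<close>

text \<open>\<open>N \<otimes>\<^sub>A P\<close> is the quotient of the free abelian group on \<open>N \<times> P\<close> by the usual relations, so
  its elements are cosets.\<close>

type_synonym ('n, 'p) tensor = "('n \<times> 'p \<Rightarrow>\<^sub>0 int) set"

definition tensor_rel ::
  "('a, 'i) ring_scheme \<Rightarrow> ('b, 'n, 'a, 'j) bimodule_scheme \<Rightarrow> ('a, 'p, 'k) module_scheme
    \<Rightarrow> ('n \<times> 'p \<Rightarrow>\<^sub>0 int) set"
  where "tensor_rel A N P =
    {frag_of (x \<oplus>\<^bsub>N\<^esub> x', y) - frag_of (x, y) - frag_of (x', y) | x x' y.
      x \<in> carrier N \<and> x' \<in> carrier N \<and> y \<in> carrier P} \<union>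
    {frag_of (x, y \<oplus>\<^bsub>P\<^esub> y') - frag_of (x, y) - frag_of (x, y') | x y y'.
      x \<in> carrier N \<and> y \<in> carrier P \<and> y' \<in> carrier P} \<union>
    {frag_of (x \<triangleleft>\<^bsub>N\<^esub> a, y) - frag_of (x, a \<odot>\<^bsub>P\<^esub> y) | x a y.
      x \<in> carrier N \<and> a \<in> carrier A \<and> y \<in> carrier P}"

definition tensor_null ::
  "('a, 'i) ring_scheme \<Rightarrow> ('b, 'n, 'a, 'j) bimodule_scheme \<Rightarrow> ('a, 'p, 'k) module_scheme
    \<Rightarrow> ('n \<times> 'p \<Rightarrow>\<^sub>0 int) set"
  where "tensor_null A N P =
    generate (free_Abelian_group (carrier N \<times> carrier P)) (tensor_rel A N P)"

definition tensor_class ::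
  "('a, 'i) ring_scheme \<Rightarrow> ('b, 'n, 'a, 'j) bimodule_scheme \<Rightarrow> ('a, 'p, 'k) module_scheme
    \<Rightarrow> ('n \<times> 'p \<Rightarrow>\<^sub>0 int) \<Rightarrow> ('n, 'p) tensor"
  where "tensor_class A N P t =
    tensor_null A N P #>\<^bsub>free_Abelian_group (carrier N \<times> carrier P)\<^esub> t"

definition pure_tensor ::
  "('a, 'i) ring_scheme \<Rightarrow> ('b, 'n, 'a, 'j) bimodule_scheme \<Rightarrow> ('a, 'p, 'k) module_scheme
    \<Rightarrow> 'n \<Rightarrow> 'p \<Rightarrow> ('n, 'p) tensor"
  where "pure_tensor A N P x y = tensor_class A N P (frag_of (x, y))"

text \<open>\<open>tensor_map A N P f g\<close> is \<open>f \<otimes>\<^sub>A g\<close>, where \<open>N\<close> and \<open>P\<close> are the codomains of \<open>f\<close> and \<open>g\<close>.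
  For linear \<open>f\<close> and \<open>g\<close> all members of the union are the same coset.\<close>

definition tensor_map ::
  "('a, 'i) ring_scheme \<Rightarrow> ('b, 'n, 'a, 'j) bimodule_scheme \<Rightarrow> ('a, 'p, 'k) module_scheme
    \<Rightarrow> ('n' \<Rightarrow> 'n) \<Rightarrow> ('p' \<Rightarrow> 'p) \<Rightarrow> ('n', 'p') tensor \<Rightarrow> ('n, 'p) tensor"
  where "tensor_map A N P f g T =
    (\<Union>t\<in>T. tensor_class A N P (frag_extend (\<lambda>(x, y). frag_of (f x, g y)) t))"

definition tensor_product ::
  "('a, 'i) ring_scheme \<Rightarrow> ('b, 'n, 'a, 'j) bimodule_scheme \<Rightarrow> ('a, 'p, 'e, 'k) bimodule_scheme
    \<Rightarrow> ('b, ('n, 'p) tensor, 'e) bimodule"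
  where "tensor_product A N P =
    (let Q = free_Abelian_group (carrier N \<times> carrier P) Mod tensor_null A N P in
      \<lparr>carrier = carrier Q, mult = undefined, one = undefined, zero = one Q, add = mult Q,
       smult = (\<lambda>b. tensor_map A N P (\<lambda>x. b \<odot>\<^bsub>N\<^esub> x) (\<lambda>y. y)),
       rsmult = (\<lambda>T e. tensor_map A N P (\<lambda>x. x) (\<lambda>y. y \<triangleleft>\<^bsub>P\<^esub> e) T)\<rparr>)"

text \<open>The canonical isomorphism \<open>(N \<otimes>\<^sub>B P) \<otimes>\<^sub>A Q \<rightarrow> N \<otimes>\<^sub>B (P \<otimes>\<^sub>A Q)\<close>; it is uniquely determined
  on the carrier by its values on pure tensors.\<close>

definition tensor_assoc ::
  "('b, 'h) ring_scheme \<Rightarrow> ('a, 'i) ring_scheme \<Rightarrow> ('e, 'n, 'b, 'j) bimodule_scheme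
    \<Rightarrow> ('b, 'p, 'a, 'k) bimodule_scheme \<Rightarrow> ('a, 'q, 'f, 'l) bimodule_scheme
    \<Rightarrow> (('n, 'p) tensor, 'q) tensor \<Rightarrow> ('n, ('p, 'q) tensor) tensor"
  where "tensor_assoc B A N P Q = (SOME \<alpha>.
    \<alpha> \<in> hom (add_monoid (tensor_product A (tensor_product B N P) Q))
            (add_monoid (tensor_product B N (tensor_product A P Q))) \<and>
    (\<forall>x\<in>carrier N. \<forall>y\<in>carrier P. \<forall>z\<in>carrier Q.
      \<alpha> (pure_tensor A (tensor_product B N P) Q (pure_tensor B N P x y) z) =
      pure_tensor B N (tensor_product A P Q) x (pure_tensor A P Q y z)))"

text \<open>Flatness is preservation of injectivity of linear maps under tensoring.  A HOL formula cannot
  quantify over all types, so the type \<open>'n\<close> containing the carriers of the test modules is a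
  parameter.  Since flatness can be tested on the inclusions of one-sided ideals into the base
  ring, taking \<open>'n\<close> to be the type of ring elements already gives flatness with respect to
  modules in every type.  A flatness hypothesis is thus an instance at the type of ring elements,
  to which instances at further types add nothing mathematically; they only spare the derivation
  of the ideal test.\<close>

definition flat_left ::
  "'n itself \<Rightarrow> ('a, 'i) ring_scheme \<Rightarrow> ('a, 'p, 'e, 'j) bimodule_scheme \<Rightarrow> bool"
  where "flat_left _ A P \<longleftrightarrow> left_module A P \<and>
    (\<forall>(N' :: (unit, 'n, 'a) bimodule) (N :: (unit, 'n, 'a) bimodule) f.
      right_module A N' \<and> right_module A N \<and> f \<in> right_linear A N' N \<and> inj_on f (carrier N') \<longrightarrow>
      inj_on (tensor_map A N P f (\<lambda>y. y)) (carrier (tensor_product A N' P)))"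

definition flat_right ::
  "'n itself \<Rightarrow> ('b, 'i) ring_scheme \<Rightarrow> ('e, 'p, 'b, 'j) bimodule_scheme \<Rightarrow> bool"
  where "flat_right _ B P \<longleftrightarrow> right_module B P \<and>
    (\<forall>(N' :: ('b, 'n, unit) bimodule) (N :: ('b, 'n, unit) bimodule) f.
      left_module B N' \<and> left_module B N \<and> f \<in> left_linear B N' N \<and> inj_on f (carrier N') \<longrightarrow>
      inj_on (tensor_map B P N (\<lambda>x. x) f) (carrier (tensor_product B P N')))"


section \<open>Corings and bicomodules\<close>

record ('a, 'c) coring = "('a, 'c, 'a) bimodule" +
  comult :: "'c \<Rightarrow> ('c, 'c) tensor"
  counit :: "'c \<Rightarrow> 'a"

text \<open>The counit laws are stated in \<open>A \<otimes>\<^sub>A C\<close> and \<open>C \<otimes>\<^sub>A A\<close>, where the canonical identifications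
  with \<open>C\<close> are \<open>c \<mapsto> 1 \<otimes> c\<close> and \<open>c \<mapsto> c \<otimes> 1\<close>; likewise for comodules below.\<close>

locale coring = bimodule R A A C
  for R :: "('r, 'i) ring_scheme" and A :: "('r, 'a, 'j) module_scheme"
    and C :: "('a, 'c, 'k) coring_scheme" +
  assumes comult_bilinear: "comult C \<in> bilinear A A C (tensor_product A C C)"
    and counit_bilinear: "counit C \<in> bilinear A A C (regular_bimodule A)"
    and coassoc: "c \<in> carrier C \<Longrightarrow>
      tensor_assoc A A C C C
        (tensor_map A (tensor_product A C C) C (comult C) (\<lambda>y. y) (comult C c)) =
      tensor_map A C (tensor_product A C C) (\<lambda>x. x) (comult C) (comult C c)"
    and counit_left: "c \<in> carrier C \<Longrightarrow>
      tensor_map A (regular_bimodule A) C (counit C) (\<lambda>y. y) (comult C c) =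
      pure_tensor A (regular_bimodule A) C \<one>\<^bsub>A\<^esub> c"
    and counit_right: "c \<in> carrier C \<Longrightarrow>
      tensor_map A C (regular_bimodule A) (\<lambda>x. x) (counit C) (comult C c) =
      pure_tensor A C (regular_bimodule A) c \<one>\<^bsub>A\<^esub>"

record ('b, 'd, 'm, 'a, 'c) bicomodule = "('b, 'm, 'a) bimodule" +
  lcoact :: "'m \<Rightarrow> ('d, 'm) tensor"
  rcoact :: "'m \<Rightarrow> ('m, 'c) tensor"

locale bicomodule =
  coring_D: coring R B D + coring_C: coring R A C + bimodule R B A M
  for R :: "('r, 'i) ring_scheme"
    and B :: "('r, 'b, 'j) module_scheme" and D :: "('b, 'd, 'k) coring_scheme"
    and A :: "('r, 'a, 'l) module_scheme" and C :: "('a, 'c, 'n) coring_scheme"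
    and M :: "('b, 'd, 'm, 'a, 'c, 'o) bicomodule_scheme" +
  assumes lcoact_bilinear: "lcoact M \<in> bilinear B A M (tensor_product B D M)"
    and rcoact_bilinear: "rcoact M \<in> bilinear B A M (tensor_product A M C)"
    and left_coassoc: "m \<in> carrier M \<Longrightarrow>
      tensor_assoc B B D D M
        (tensor_map B (tensor_product B D D) M (comult D) (\<lambda>y. y) (lcoact M m)) =
      tensor_map B D (tensor_product B D M) (\<lambda>x. x) (lcoact M) (lcoact M m)"
    and left_counit: "m \<in> carrier M \<Longrightarrow>
      tensor_map B (regular_bimodule B) M (counit D) (\<lambda>y. y) (lcoact M m) =
      pure_tensor B (regular_bimodule B) M \<one>\<^bsub>B\<^esub> m"
    and right_coassoc: "m \<in> carrier M \<Longrightarrow>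
      tensor_assoc A A M C C
        (tensor_map A (tensor_product A M C) C (rcoact M) (\<lambda>y. y) (rcoact M m)) =
      tensor_map A M (tensor_product A C C) (\<lambda>x. x) (comult C) (rcoact M m)"
    and right_counit: "m \<in> carrier M \<Longrightarrow>
      tensor_map A M (regular_bimodule A) (\<lambda>x. x) (counit C) (rcoact M m) =
      pure_tensor A M (regular_bimodule A) m \<one>\<^bsub>A\<^esub>"
    and compatible: "m \<in> carrier M \<Longrightarrow>
      tensor_assoc B A D M C
        (tensor_map A (tensor_product B D M) C (lcoact M) (\<lambda>y. y) (rcoact M m)) =
      tensor_map B D (tensor_product A M C) (\<lambda>x. x) (rcoact M) (lcoact M m)"

definition bicolinear ::
  "('b, 'i) ring_scheme \<Rightarrow> ('b, 'd, 'j) coring_scheme \<Rightarrow> ('a, 'k) ring_scheme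
    \<Rightarrow> ('a, 'c, 'l) coring_scheme \<Rightarrow> ('b, 'd, 'm, 'a, 'c, 'o) bicomodule_scheme
    \<Rightarrow> ('b, 'd, 'n, 'a, 'c, 'p) bicomodule_scheme \<Rightarrow> ('m \<Rightarrow> 'n) set"
  where "bicolinear B D A C M N = {f \<in> bilinear B A M N. \<forall>x\<in>carrier M.
    tensor_map B D N (\<lambda>d. d) f (lcoact M x) = lcoact N (f x) \<and>
    tensor_map A N C f (\<lambda>c. c) (rcoact M x) = rcoact N (f x)}"

text \<open>Endomorphisms are normalised to be \<open>undefined\<close> outside the carrier.\<close>

definition bicomodule_End ::
  "('b, 'i) ring_scheme \<Rightarrow> ('b, 'd, 'j) coring_scheme \<Rightarrow> ('a, 'k) ring_scheme
    \<Rightarrow> ('a, 'c, 'l) coring_scheme \<Rightarrow> ('b, 'd, 'm, 'a, 'c, 'o) bicomodule_scheme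
    \<Rightarrow> ('m \<Rightarrow> 'm) ring"
  where "bicomodule_End B D A C M =
    \<lparr>carrier = bicolinear B D A C M M \<inter> extensional (carrier M),
     mult = (\<lambda>f g. compose (carrier M) g f),
     one = (\<lambda>x\<in>carrier M. x),
     zero = (\<lambda>x\<in>carrier M. \<zero>\<^bsub>M\<^esub>),
     add = (\<lambda>f g. \<lambda>x\<in>carrier M. f x \<oplus>\<^bsub>M\<^esub> g x)\<rparr>"

text \<open>A subbicomodule is a subset carrying a bicomodule structure for which the inclusion is a
  morphism.\<close>

definition subbicomodule ::
  "('r, 'h) ring_scheme \<Rightarrow> ('r, 'b, 'i) module_scheme \<Rightarrow> ('b, 'd, 'j) coring_scheme
    \<Rightarrow> ('r, 'a, 'k) module_scheme \<Rightarrow> ('a, 'c, 'l) coring_scheme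
    \<Rightarrow> ('b, 'd, 'm, 'a, 'c, 'o) bicomodule_scheme \<Rightarrow> 'm set \<Rightarrow> bool"
  where "subbicomodule R B D A C M L \<longleftrightarrow> L \<subseteq> carrier M \<and>
    (\<exists>l r. let N = M\<lparr>carrier := L, lcoact := l, rcoact := r\<rparr> in
      bicomodule R B D A C N \<and> (\<lambda>x. x) \<in> bicolinear B D A C N M)"

definition fully_invariant ::
  "('r, 'h) ring_scheme \<Rightarrow> ('r, 'b, 'i) module_scheme \<Rightarrow> ('b, 'd, 'j) coring_scheme
    \<Rightarrow> ('r, 'a, 'k) module_scheme \<Rightarrow> ('a, 'c, 'l) coring_scheme
    \<Rightarrow> ('b, 'd, 'm, 'a, 'c, 'o) bicomodule_scheme \<Rightarrow> 'm set \<Rightarrow> bool"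
  where "fully_invariant R B D A C M L \<longleftrightarrow> subbicomodule R B D A C M L \<and>
    (\<forall>f\<in>carrier (bicomodule_End B D A C M). f ` L \<subseteq> L)"

definition duo ::
  "('r, 'h) ring_scheme \<Rightarrow> ('r, 'b, 'i) module_scheme \<Rightarrow> ('b, 'd, 'j) coring_scheme
    \<Rightarrow> ('r, 'a, 'k) module_scheme \<Rightarrow> ('a, 'c, 'l) coring_scheme
    \<Rightarrow> ('b, 'd, 'm, 'a, 'c, 'o) bicomodule_scheme \<Rightarrow> bool"
  where "duo R B D A C M \<longleftrightarrow>
    (\<forall>L. subbicomodule R B D A C M L \<longrightarrow> fully_invariant R B D A C M L)"


section \<open>Fully coprime subbicomodules and the Zariski topology\<close>

definition An ::
  "('b, 'i) ring_scheme \<Rightarrow> ('b, 'd, 'j) coring_scheme \<Rightarrow> ('a, 'k) ring_scheme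
    \<Rightarrow> ('a, 'c, 'l) coring_scheme \<Rightarrow> ('b, 'd, 'm, 'a, 'c, 'o) bicomodule_scheme
    \<Rightarrow> 'm set \<Rightarrow> ('m \<Rightarrow> 'm) set"
  where "An B D A C M X = {f \<in> carrier (bicomodule_End B D A C M). f ` X \<subseteq> {\<zero>\<^bsub>M\<^esub>}}"

definition colon ::
  "('b, 'i) ring_scheme \<Rightarrow> ('b, 'd, 'j) coring_scheme \<Rightarrow> ('a, 'k) ring_scheme
    \<Rightarrow> ('a, 'c, 'l) coring_scheme \<Rightarrow> ('b, 'd, 'm, 'a, 'c, 'o) bicomodule_scheme
    \<Rightarrow> 'm set \<Rightarrow> 'm set \<Rightarrow> 'm set"
  where "colon B D A C M X Y = (\<Inter>f\<in>An B D A C M X. f -` Y \<inter> carrier M)"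

definition fully_coprime ::
  "('r, 'h) ring_scheme \<Rightarrow> ('r, 'b, 'i) module_scheme \<Rightarrow> ('b, 'd, 'j) coring_scheme
    \<Rightarrow> ('r, 'a, 'k) module_scheme \<Rightarrow> ('a, 'c, 'l) coring_scheme
    \<Rightarrow> ('b, 'd, 'm, 'a, 'c, 'o) bicomodule_scheme \<Rightarrow> 'm set \<Rightarrow> bool"
  where "fully_coprime R B D A C M K \<longleftrightarrow>
    fully_invariant R B D A C M K \<and> K \<noteq> {\<zero>\<^bsub>M\<^esub>} \<and>
    (\<forall>X Y. fully_invariant R B D A C M X \<and> fully_invariant R B D A C M Y \<and>
      K \<subseteq> colon B D A C M X Y \<longrightarrow> K \<subseteq> X \<or> K \<subseteq> Y)"

definition CPSpec ::
  "('r, 'h) ring_scheme \<Rightarrow> ('r, 'b, 'i) module_scheme \<Rightarrow> ('b, 'd, 'j) coring_scheme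
    \<Rightarrow> ('r, 'a, 'k) module_scheme \<Rightarrow> ('a, 'c, 'l) coring_scheme
    \<Rightarrow> ('b, 'd, 'm, 'a, 'c, 'o) bicomodule_scheme \<Rightarrow> 'm set set"
  where "CPSpec R B D A C M = {K. fully_coprime R B D A C M K}"

definition V_set ::
  "('r, 'h) ring_scheme \<Rightarrow> ('r, 'b, 'i) module_scheme \<Rightarrow> ('b, 'd, 'j) coring_scheme
    \<Rightarrow> ('r, 'a, 'k) module_scheme \<Rightarrow> ('a, 'c, 'l) coring_scheme
    \<Rightarrow> ('b, 'd, 'm, 'a, 'c, 'o) bicomodule_scheme \<Rightarrow> 'm set \<Rightarrow> 'm set set"
  where "V_set R B D A C M L = {K \<in> CPSpec R B D A C M. K \<subseteq> L}"

definition X_set ::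
  "('r, 'h) ring_scheme \<Rightarrow> ('r, 'b, 'i) module_scheme \<Rightarrow> ('b, 'd, 'j) coring_scheme
    \<Rightarrow> ('r, 'a, 'k) module_scheme \<Rightarrow> ('a, 'c, 'l) coring_scheme
    \<Rightarrow> ('b, 'd, 'm, 'a, 'c, 'o) bicomodule_scheme \<Rightarrow> 'm set \<Rightarrow> 'm set set"
  where "X_set R B D A C M L = {K \<in> CPSpec R B D A C M. \<not> K \<subseteq> L}"

definition xi ::
  "('r, 'h) ring_scheme \<Rightarrow> ('r, 'b, 'i) module_scheme \<Rightarrow> ('b, 'd, 'j) coring_scheme
    \<Rightarrow> ('r, 'a, 'k) module_scheme \<Rightarrow> ('a, 'c, 'l) coring_scheme
    \<Rightarrow> ('b, 'd, 'm, 'a, 'c, 'o) bicomodule_scheme \<Rightarrow> 'm set set set"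
  where "xi R B D A C M = V_set R B D A C M ` {L. subbicomodule R B D A C M L}"

definition tau ::
  "('r, 'h) ring_scheme \<Rightarrow> ('r, 'b, 'i) module_scheme \<Rightarrow> ('b, 'd, 'j) coring_scheme
    \<Rightarrow> ('r, 'a, 'k) module_scheme \<Rightarrow> ('a, 'c, 'l) coring_scheme
    \<Rightarrow> ('b, 'd, 'm, 'a, 'c, 'o) bicomodule_scheme \<Rightarrow> 'm set set set"
  where "tau R B D A C M = X_set R B D A C M ` {L. subbicomodule R B D A C M L}"

definition tau_fi ::
  "('r, 'h) ring_scheme \<Rightarrow> ('r, 'b, 'i) module_scheme \<Rightarrow> ('b, 'd, 'j) coring_scheme
    \<Rightarrow> ('r, 'a, 'k) module_scheme \<Rightarrow> ('a, 'c, 'l) coring_scheme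
    \<Rightarrow> ('b, 'd, 'm, 'a, 'c, 'o) bicomodule_scheme \<Rightarrow> 'm set set set"
  where "tau_fi R B D A C M = X_set R B D A C M ` {L. fully_invariant R B D A C M L}"

definition top_bicomodule ::
  "('r, 'h) ring_scheme \<Rightarrow> ('r, 'b, 'i) module_scheme \<Rightarrow> ('b, 'd, 'j) coring_scheme
    \<Rightarrow> ('r, 'a, 'k) module_scheme \<Rightarrow> ('a, 'c, 'l) coring_scheme
    \<Rightarrow> ('b, 'd, 'm, 'a, 'c, 'o) bicomodule_scheme \<Rightarrow> bool"
  where "top_bicomodule R B D A C M \<longleftrightarrow>
    (\<forall>F. finite F \<and> F \<subseteq> xi R B D A C M \<longrightarrow> \<Union>F \<in> xi R B D A C M)"

text \<open>\<open>istopology\<close> does not mention the underlying set, which is recovered as the largest open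
  set.\<close>

definition is_topology_on :: "'x set \<Rightarrow> 'x set set \<Rightarrow> bool"
  where "is_topology_on S \<tau> \<longleftrightarrow>
    istopology (\<lambda>U. U \<in> \<tau>) \<and> topspace (topology (\<lambda>U. U \<in> \<tau>)) = S"

end

theory Submission
  imports Defs
begin

text \<open>
  A closed set of the topology has the form \<open>V L = {K. K \<subseteq> L}\<close> with \<open>L\<close> fully invariant and \<open>K\<close>
  ranging over the fully coprime subbicomodules.  The argument only ever forms sums of fully
  invariant subbicomodules:

  \<^item> \<open>V L \<union> V N = V (L + N)\<close>.  An endomorphism that kills \<open>L\<close> maps \<open>L + N\<close> into \<open>N\<close>, so that
    \<open>L + N \<subseteq> (L : N)\<close>; hence a fully coprime \<open>K \<subseteq> L + N\<close> lies in \<open>L\<close> or in \<open>N\<close>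
    (\<open>Spec_subset_sum_iff\<close>).
  \<^item> \<open>\<Inter>i. V (L i) = V S\<close>, where \<open>S\<close> is the sum of all fully invariant subbicomodules below every
    \<open>L i\<close> (\<open>X_set_Union\<close>).  The set-theoretic intersection of infinitely many subbicomodules need
    not carry coactions, but a fully coprime \<open>K\<close> is itself fully invariant, so \<open>K\<close> lies in the
    intersection if and only if it is one of the summands of \<open>S\<close>, if and only if \<open>K \<subseteq> S\<close>.
  \<^item> The empty sum \<open>0\<close> contains no fully coprime \<open>K\<close>.

  If \<open>M\<close> is duo, all subbicomodules are fully invariant and the two topologies coincide.

  The substance of the proof is therefore that a sum \<open>N = \<Sum>i. N i\<close> of subbicomodules is a
  subbicomodule (\<open>subbicomodule_sum\<close>).  Flatness of \<open>C\<close> makes \<open>N \<otimes> C \<rightarrow> M \<otimes> C\<close> injective.  The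
  coaction of \<open>M\<close> sends the generators in \<open>N i\<close> into the image of this map, because \<open>N i\<close> has a
  coaction of its own, and so it restricts to \<open>N\<close> (\<open>lift_bilinear\<close>).  The comodule
  laws come from the summands and not from \<open>M\<close>: both sides of each law are additive in the element,
  and they are natural with respect to the inclusions \<open>N i \<rightarrow> N\<close>, so that the laws of the \<open>N i\<close> yield
  those of \<open>N\<close> (\<open>bicomodule_if_generated\<close>).  Naturality of coassociativity and compatibility requires the
  associativity isomorphism of the tensor product to exist as an additive map with the prescribed
  values on pure tensors, and to be natural; this follows from the universal property of the tensor
  product.
\<close>

section \<open>Additive maps and generated subgroups\<close>

abbreviation additive_maps :: "('m, 'i) ring_scheme \<Rightarrow> ('n, 'j) ring_scheme \<Rightarrow> ('m \<Rightarrow> 'n) set"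
  where "additive_maps M N \<equiv> hom (add_monoid M) (add_monoid N)"

lemma additive_mapsI:
  assumes "\<And>x. x \<in> carrier M \<Longrightarrow> f x \<in> carrier N"
    and "\<And>x y. \<lbrakk>x \<in> carrier M; y \<in> carrier M\<rbrakk> \<Longrightarrow> f (x \<oplus>\<^bsub>M\<^esub> y) = f x \<oplus>\<^bsub>N\<^esub> f y"
  shows "f \<in> additive_maps M N"
  using assms by (auto simp: hom_def)

lemma additive_closed: "\<lbrakk>f \<in> additive_maps M N; x \<in> carrier M\<rbrakk> \<Longrightarrow> f x \<in> carrier N"
  by (auto simp: hom_def)

lemma additive_add:
  "\<lbrakk>f \<in> additive_maps M N; x \<in> carrier M; y \<in> carrier M\<rbrakk> \<Longrightarrow> f (x \<oplus>\<^bsub>M\<^esub> y) = f x \<oplus>\<^bsub>N\<^esub> f y"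
  by (auto simp: hom_def)

lemma additive_comp:
  assumes "f \<in> additive_maps M N" and "g \<in> additive_maps N P"
  shows "(\<lambda>x. g (f x)) \<in> additive_maps M P"
  by (rule additive_mapsI)
    (simp_all add: additive_closed[OF assms(1)] additive_closed[OF assms(2)] additive_add[OF assms(1)]
      additive_add[OF assms(2)])

lemma additive_sum:
  assumes "abelian_group N" and "f \<in> additive_maps M N" and "g \<in> additive_maps M N"
  shows "(\<lambda>x. f x \<oplus>\<^bsub>N\<^esub> g x) \<in> additive_maps M N"
proof -
  interpret N: abelian_group N by fact
  show ?thesis
    using assms(2,3) by (auto intro!: additive_mapsI simp: additive_add additive_closed N.a_ac)
qed

lemma additive_group_hom:
  assumes "abelian_group M" and "abelian_group N" and "f \<in> additive_maps M N"
  shows "group_hom (add_monoid M) (add_monoid N) f"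
  using assms by (simp add: group_hom_def group_hom_axioms_def abelian_group.a_group)

lemma additive_zero:
  assumes "abelian_group M" and "abelian_group N" and "f \<in> additive_maps M N"
  shows "f \<zero>\<^bsub>M\<^esub> = \<zero>\<^bsub>N\<^esub>"
  using group_hom.hom_one[OF additive_group_hom[OF assms]] by simp

lemma additive_inv:
  assumes "abelian_group M" and "abelian_group N" and "f \<in> additive_maps M N" and "x \<in> carrier M"
  shows "f (\<ominus>\<^bsub>M\<^esub> x) = \<ominus>\<^bsub>N\<^esub> f x"
  using group_hom.hom_inv[OF additive_group_hom[OF assms(1-3)]] assms(4) by (simp add: a_inv_def)

lemma subgroup_preimage:
  assumes "abelian_group M" and "abelian_group N" and "f \<in> additive_maps M N"
    and "subgroup H (add_monoid N)"
  shows "subgroup {x \<in> carrier M. f x \<in> H} (add_monoid M)"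
proof -
  interpret M: abelian_group M by fact
  interpret N: abelian_group N by fact
  note [simp] = additive_zero[OF assms(1-3)] additive_inv[OF assms(1-3)] additive_add[OF assms(3)]
  show ?thesis
    using subgroup.m_closed[OF assms(4)] subgroup.one_closed[OF assms(4)]
      subgroup.m_inv_closed[OF assms(4)]
    by (intro subgroup.intro) (auto simp flip: a_inv_def)
qed

text \<open>The preimage of a subgroup under an additive map is a subgroup, so membership need only be tested on
generators.  This is how stability under actions and endomorphisms passes to sums.\<close>

lemma additive_image_generate:
  assumes "abelian_group M" and "abelian_group N" and "f \<in> additive_maps M N"
    and "subgroup H (add_monoid N)" and "G \<subseteq> carrier M" and "f ` G \<subseteq> H"
    and "x \<in> generate (add_monoid M) G"
  shows "f x \<in> H"
proof -
  interpret M: group "add_monoid M" using assms(1) by (rule abelian_group.a_group)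
  have "generate (add_monoid M) G \<subseteq> {x \<in> carrier M. f x \<in> H}"
    using assms(5,6) subgroup_preimage[OF assms(1-4)]
    by (intro M.generate_subgroup_incl) auto
  then show ?thesis
    using assms(7) by auto
qed

lemma additive_eq_on_generate:
  assumes "abelian_group M" and "abelian_group N"
    and f: "f \<in> additive_maps M N" and g: "g \<in> additive_maps M N"
    and "G \<subseteq> carrier M" and "\<And>x. x \<in> G \<Longrightarrow> f x = g x"
    and "x \<in> generate (add_monoid M) G"
  shows "f x = g x"
proof -
  interpret M: group "add_monoid M" using assms(1) by (rule abelian_group.a_group)
  interpret N: abelian_group N by fact
  have "subgroup {x \<in> carrier M. f x = g x} (add_monoid M)"
    using abelian_groupE(1,2)[OF assms(1)] abelian_group.a_inv_closed[OF assms(1)]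
    by (intro subgroup.intro)
      (auto simp: additive_add[OF f] additive_add[OF g] additive_zero[OF assms(1,2) f]
        additive_zero[OF assms(1,2) g] additive_inv[OF assms(1,2) f] additive_inv[OF assms(1,2) g]
        simp flip: a_inv_def)
  then have "generate (add_monoid M) G \<subseteq> {x \<in> carrier M. f x = g x}"
    using assms(5,6) by (intro M.generate_subgroup_incl) auto
  then show ?thesis
    using assms(7) by auto
qed


section \<open>The tensor product and its universal property\<close>

text \<open>Tensor products of two-sided modules only involve the ring actions and their commutation.  Leaving
out the common base ring of the two algebras makes it possible to iterate the construction without
tracking that the induced actions of the base ring agree.\<close>

locale two_sided_module = left_module B M + right_module A M
  for B :: "('b, 'h) ring_scheme" and A :: "('a, 'i) ring_scheme"
    and M :: "('b, 'm, 'a, 'j) bimodule_scheme" +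
  assumes commute: "\<lbrakk>b \<in> carrier B; x \<in> carrier M; a \<in> carrier A\<rbrakk> \<Longrightarrow>
      (b \<odot>\<^bsub>M\<^esub> x) \<triangleleft>\<^bsub>M\<^esub> a = b \<odot>\<^bsub>M\<^esub> (x \<triangleleft>\<^bsub>M\<^esub> a)"

locale tensor_factors = left: right_module A N + right: left_module A P
  for A :: "('a, 'i) ring_scheme" and N :: "('b, 'n, 'a, 'j) bimodule_scheme"
    and P :: "('a, 'p, 'e, 'k) bimodule_scheme"
begin

abbreviation free where "free \<equiv> free_Abelian_group (carrier N \<times> carrier P)"
abbreviation T where "T \<equiv> tensor_product A N P"
abbreviation cls where "cls \<equiv> tensor_class A N P"
abbreviation pure (infixl \<open>\<otimes>\<^sub>t\<close> 75) where "pure \<equiv> pure_tensor A N P"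

lemma tensor_rel_subset: "tensor_rel A N P \<subseteq> carrier free"
proof
  fix u assume "u \<in> tensor_rel A N P"
  then show "u \<in> carrier free"
    unfolding tensor_rel_def
    by (auto dest!: subsetD[OF keys_diff] simp: left.r_closed right.l_closed)
qed

lemma null_subgroup: "subgroup (tensor_null A N P) free"
  unfolding tensor_null_def
  by (rule group.generate_is_subgroup) (use tensor_rel_subset in simp_all)

lemma null_normal: "tensor_null A N P \<lhd> free"
  using null_subgroup abelian_free_Abelian_group comm_group.normal_iff_subgroup by blast

lemma quotient_comm_group: "comm_group (free Mod tensor_null A N P)"
  using abelian_free_Abelian_group null_subgroup by (rule comm_group.abelian_FactGroup)

lemma tensor_sel:
  "carrier T = carrier (free Mod tensor_null A N P)"
  "add T = mult (free Mod tensor_null A N P)"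
  "zero T = one (free Mod tensor_null A N P)"
  by (simp_all add: tensor_product_def Let_def)

lemma tensor_abelian: "abelian_group T"
  using comm_groupE[OF quotient_comm_group]
  by (intro abelian_groupI) (simp_all add: tensor_sel del: mult_FactGroup one_FactGroup)

lemma carrier_tensor: "carrier T = cls ` carrier free"
  by (auto simp: tensor_sel carrier_FactGroup tensor_class_def)

lemma class_closed: "t \<in> carrier free \<Longrightarrow> cls t \<in> carrier T"
  by (simp only: carrier_tensor imageI)

lemma class_add:
  assumes "s \<in> carrier free" and "t \<in> carrier free"
  shows "cls (s + t) = cls s \<oplus>\<^bsub>T\<^esub> cls t"
  using normal.rcos_sum[OF null_normal assms] by (simp add: tensor_sel tensor_class_def)

lemma class_eqI:
  assumes "s \<in> carrier free" and "t \<in> carrier free" and "s - t \<in> tensor_null A N P"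
  shows "cls s = cls t"
proof -
  have "s \<in> tensor_null A N P #>\<^bsub>free\<^esub> t"
    using assms(3) by (auto simp: r_coset_def intro!: bexI[of _ "s - t"])
  then show ?thesis
    unfolding tensor_class_def
    using group.repr_independence[OF group_free_Abelian_group _ assms(2) null_subgroup] by blast
qed

lemma class_eq_rel:
  assumes "s \<in> carrier free" and "t \<in> carrier free" and "s - t \<in> tensor_rel A N P"
  shows "cls s = cls t"
proof (rule class_eqI[OF assms(1,2)])
  show "s - t \<in> tensor_null A N P"
    using assms(3) unfolding tensor_null_def by (rule generate.incl)
qed

lemma pure_closed: "\<lbrakk>x \<in> carrier N; y \<in> carrier P\<rbrakk> \<Longrightarrow> x \<otimes>\<^sub>t y \<in> carrier T"
  by (simp add: pure_tensor_def class_closed)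

lemma pure_add_left:
  assumes "x \<in> carrier N" and "x' \<in> carrier N" and "y \<in> carrier P"
  shows "(x \<oplus>\<^bsub>N\<^esub> x') \<otimes>\<^sub>t y = x \<otimes>\<^sub>t y \<oplus>\<^bsub>T\<^esub> x' \<otimes>\<^sub>t y"
proof -
  have "cls (frag_of (x \<oplus>\<^bsub>N\<^esub> x', y)) = cls (frag_of (x, y) + frag_of (x', y))"
  proof (rule class_eq_rel)
    show "frag_of (x, y) + frag_of (x', y) \<in> carrier free"
      using assms by (auto dest!: subsetD[OF keys_add])
    show "frag_of (x \<oplus>\<^bsub>N\<^esub> x', y) - (frag_of (x, y) + frag_of (x', y)) \<in> tensor_rel A N P"
      unfolding tensor_rel_def using assms by (auto simp: diff_diff_eq[symmetric])
  qed (use assms in auto)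
  then show ?thesis
    using assms by (simp add: pure_tensor_def class_add)
qed

lemma pure_add_right:
  assumes "x \<in> carrier N" and "y \<in> carrier P" and "y' \<in> carrier P"
  shows "x \<otimes>\<^sub>t (y \<oplus>\<^bsub>P\<^esub> y') = x \<otimes>\<^sub>t y \<oplus>\<^bsub>T\<^esub> x \<otimes>\<^sub>t y'"
proof -
  have "cls (frag_of (x, y \<oplus>\<^bsub>P\<^esub> y')) = cls (frag_of (x, y) + frag_of (x, y'))"
  proof (rule class_eq_rel)
    show "frag_of (x, y) + frag_of (x, y') \<in> carrier free"
      using assms by (auto dest!: subsetD[OF keys_add])
    show "frag_of (x, y \<oplus>\<^bsub>P\<^esub> y') - (frag_of (x, y) + frag_of (x, y')) \<in> tensor_rel A N P"
      unfolding tensor_rel_def using assms by (auto simp: diff_diff_eq[symmetric])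
  qed (use assms in auto)
  then show ?thesis
    using assms by (simp add: pure_tensor_def class_add)
qed

lemma pure_balanced:
  assumes "x \<in> carrier N" and "a \<in> carrier A" and "y \<in> carrier P"
  shows "(x \<triangleleft>\<^bsub>N\<^esub> a) \<otimes>\<^sub>t y = x \<otimes>\<^sub>t (a \<odot>\<^bsub>P\<^esub> y)"
  unfolding pure_tensor_def
proof (rule class_eq_rel)
  show "frag_of (x \<triangleleft>\<^bsub>N\<^esub> a, y) - frag_of (x, a \<odot>\<^bsub>P\<^esub> y) \<in> tensor_rel A N P"
    unfolding tensor_rel_def using assms by blast
qed (use assms left.r_closed right.l_closed in auto)

text \<open>Pure tensors generate.  All identities between maps out of a tensor product are proved in this way.\<close>

lemma tensor_ext:
  assumes "abelian_group G"
    and f: "f \<in> additive_maps T G" and g: "g \<in> additive_maps T G"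
    and eq: "\<And>x y. \<lbrakk>x \<in> carrier N; y \<in> carrier P\<rbrakk> \<Longrightarrow> f (x \<otimes>\<^sub>t y) = g (x \<otimes>\<^sub>t y)"
    and "t \<in> carrier T"
  shows "f t = g t"
proof -
  interpret G: abelian_group G by fact
  interpret F: group free by simp
  have hom: "group_hom free (add_monoid G) (\<lambda>u. h (cls u))" if "h \<in> additive_maps T G" for h
    using that class_closed class_add
    by (simp add: group_hom_def group_hom_axioms_def G.a_group) (auto simp: hom_def)
  have diff: "h (cls (u - v)) = h (cls u) \<ominus>\<^bsub>G\<^esub> h (cls v)"
    if "h \<in> additive_maps T G" "u \<in> carrier free" "v \<in> carrier free" for h u v
    using group_hom.hom_mult[OF hom[OF that(1)], of u "- v"] group_hom.hom_inv[OF hom[OF that(1)], of v] that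
    by (simp add: a_minus_def a_inv_def)
  have "f (cls u) = g (cls u)" if "Poly_Mapping.keys u \<subseteq> carrier N \<times> carrier P" for u
    using that
  proof (rule free_Abelian_group_induct)
    show "f (cls 0) = g (cls 0)"
      using group_hom.hom_one[OF hom[OF f]] group_hom.hom_one[OF hom[OF g]] by simp
  qed (use eq in \<open>auto simp: diff[OF f] diff[OF g] pure_tensor_def\<close>)
  then show ?thesis
    using \<open>t \<in> carrier T\<close> by (auto simp: carrier_tensor)
qed

text \<open>A balanced biadditive map extends to the free group on pairs; the three hypotheses on it say that the
extension kills the three kinds of defining relations, so that it factors through the quotient.\<close>

lemma tensor_universal:
  assumes "abelian_group G"
    and closed: "\<And>x y. \<lbrakk>x \<in> carrier N; y \<in> carrier P\<rbrakk> \<Longrightarrow> \<beta> x y \<in> carrier G"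
    and addl: "\<And>x x' y. \<lbrakk>x \<in> carrier N; x' \<in> carrier N; y \<in> carrier P\<rbrakk> \<Longrightarrow>
      \<beta> (x \<oplus>\<^bsub>N\<^esub> x') y = \<beta> x y \<oplus>\<^bsub>G\<^esub> \<beta> x' y"
    and addr: "\<And>x y y'. \<lbrakk>x \<in> carrier N; y \<in> carrier P; y' \<in> carrier P\<rbrakk> \<Longrightarrow>
      \<beta> x (y \<oplus>\<^bsub>P\<^esub> y') = \<beta> x y \<oplus>\<^bsub>G\<^esub> \<beta> x y'"
    and bal: "\<And>x a y. \<lbrakk>x \<in> carrier N; a \<in> carrier A; y \<in> carrier P\<rbrakk> \<Longrightarrow>
      \<beta> (x \<triangleleft>\<^bsub>N\<^esub> a) y = \<beta> x (a \<odot>\<^bsub>P\<^esub> y)"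
  obtains h where "h \<in> additive_maps T G"
    and "\<And>x y. \<lbrakk>x \<in> carrier N; y \<in> carrier P\<rbrakk> \<Longrightarrow> h (x \<otimes>\<^sub>t y) = \<beta> x y"
proof -
  interpret G: abelian_group G by fact
  interpret F: group free by simp
  have "(\<lambda>(x, y). \<beta> x y) ` (carrier N \<times> carrier P) \<subseteq> carrier (add_monoid G)"
    using closed by auto
  then obtain k where k: "k \<in> hom free (add_monoid G)"
    and k_of': "\<And>u. u \<in> carrier N \<times> carrier P \<Longrightarrow> k (frag_of u) = (\<lambda>(x, y). \<beta> x y) u"
    using comm_group.free_Abelian_group_universal[OF G.a_comm_group] by metis
  have k_of: "k (frag_of (x, y)) = \<beta> x y" if "x \<in> carrier N" "y \<in> carrier P" for x y
    using k_of'[of "(x, y)"] that by simp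
  interpret k: group_hom free "add_monoid G" k
    using k by (simp add: group_hom_def group_hom_axioms_def G.a_group)
  have k_diff: "k (u - v) = k u \<ominus>\<^bsub>G\<^esub> k v" if "u \<in> carrier free" "v \<in> carrier free" for u v
    using k.hom_mult[of u "- v"] k.hom_inv[of v] that by (simp add: a_minus_def a_inv_def)
  have "tensor_rel A N P \<subseteq> kernel free (add_monoid G) k"
  proof
    fix u assume u: "u \<in> tensor_rel A N P"
    then have uF: "u \<in> carrier free"
      using tensor_rel_subset by blast
    have *: "frag_of (x, y) \<in> carrier free" if "x \<in> carrier N" "y \<in> carrier P" for x y
      using that by simp
    have **: "s - t \<in> carrier free" if "s \<in> carrier free" "t \<in> carrier free" for s t
      using that keys_diff[of s t] by auto
    have cancel: "x \<oplus>\<^bsub>G\<^esub> y \<ominus>\<^bsub>G\<^esub> x \<ominus>\<^bsub>G\<^esub> y = \<zero>\<^bsub>G\<^esub>" if "x \<in> carrier G" "y \<in> carrier G" for x y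
      using that G.r_neg[of "x \<oplus>\<^bsub>G\<^esub> y"] by (simp add: G.minus_eq G.a_assoc G.minus_add)
    from u have "k u = \<zero>\<^bsub>G\<^esub>"
      unfolding tensor_rel_def
      by (elim UnE CollectE exE conjE)
        (simp_all add: k_diff * ** k_of closed addl addr bal left.r_closed right.l_closed
          cancel G.minus_eq[of "\<beta> _ _" "\<beta> _ _"] G.r_neg del: carrier_free_Abelian_group_iff frag_of_in_free_Abelian_group)
    then show "u \<in> kernel free (add_monoid G) k"
      using uF by (simp add: kernel_def)
  qed
  then have "tensor_null A N P \<subseteq> kernel free (add_monoid G) k"
    unfolding tensor_null_def by (rule F.generate_subgroup_incl[OF _ k.subgroup_kernel])
  then obtain h where h: "h \<in> hom (free Mod tensor_null A N P) (add_monoid G)"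
    and h_class: "\<And>u. u \<in> carrier free \<Longrightarrow> h (tensor_null A N P #>\<^bsub>free\<^esub> u) = k u"
    using k.FactGroup_universal_kernel[OF null_normal] by metis
  show thesis
  proof (rule that)
    show "h \<in> additive_maps T G"
      using h by (simp add: hom_def tensor_sel)
    show "h (x \<otimes>\<^sub>t y) = \<beta> x y" if "x \<in> carrier N" "y \<in> carrier P" for x y
      using that h_class k_of by (simp add: pure_tensor_def tensor_class_def)
  qed
qed

end

section \<open>Functoriality of the tensor product\<close>

lemma tensor_factorsI:
  assumes "two_sided_module B A N" and "two_sided_module A E P"
  shows "tensor_factors A N P"
  using assms by (simp add: tensor_factors_def two_sided_module_def)

lemma right_linear_additive: "f \<in> right_linear A M N \<Longrightarrow> f \<in> additive_maps M N"
  by (simp add: right_linear_def)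

lemma left_linear_additive: "f \<in> left_linear A M N \<Longrightarrow> f \<in> additive_maps M N"
  by (simp add: left_linear_def)

lemma bilinear_additive: "f \<in> bilinear B A M N \<Longrightarrow> f \<in> additive_maps M N"
  by (simp add: bilinear_def left_linear_def)

lemma bilinear_left: "f \<in> bilinear B A M N \<Longrightarrow> f \<in> left_linear B M N"
  by (simp add: bilinear_def)

lemma bilinear_right: "f \<in> bilinear B A M N \<Longrightarrow> f \<in> right_linear A M N"
  by (simp add: bilinear_def)

lemma id_bilinear: "(\<lambda>x. x) \<in> bilinear B A M M"
  by (simp add: bilinear_def left_linear_def right_linear_def hom_def)

lemmas id_left_linear = id_bilinear[THEN bilinear_left]
  and id_right_linear = id_bilinear[THEN bilinear_right]

text \<open>The union in the definition of \<open>tensor_map\<close> is a single coset: for linear maps, the induced map of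
free groups carries the defining relations of the source into those of the target.\<close>

lemma tensor_map_class:
  assumes "tensor_factors A N P" and "tensor_factors A N' P'"
    and f: "f \<in> right_linear A N N'" and g: "g \<in> left_linear A P P'"
    and t: "t \<in> carrier (free_Abelian_group (carrier N \<times> carrier P))"
  defines "\<epsilon> \<equiv> frag_extend (\<lambda>(x, y). frag_of (f x, g y))"
  shows "\<epsilon> t \<in> carrier (free_Abelian_group (carrier N' \<times> carrier P'))" (is "_ \<in> carrier ?F'")
    and "tensor_map A N' P' f g (tensor_class A N P t) = tensor_class A N' P' (\<epsilon> t)"
proof -
  interpret X: tensor_factors A N P by fact
  interpret Y: tensor_factors A N' P' by fact
  have fN: "f x \<in> carrier N'" if "x \<in> carrier N" for x
    using additive_closed[OF right_linear_additive[OF f]] that .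
  have gP: "g y \<in> carrier P'" if "y \<in> carrier P" for y
    using additive_closed[OF left_linear_additive[OF g]] that .
  have closed: "\<epsilon> u \<in> carrier Y.free" if "u \<in> carrier X.free" for u
  proof -
    have "Poly_Mapping.keys (frag_of (f (fst z), g (snd z))) \<subseteq> carrier N' \<times> carrier P'" if "z \<in> Poly_Mapping.keys u" for z
      using that \<open>u \<in> _\<close> fN gP by auto
    then have "(\<Union>z\<in>Poly_Mapping.keys u. Poly_Mapping.keys ((\<lambda>(x, y). frag_of (f x, g y)) z)) \<subseteq> carrier N' \<times> carrier P'"
      by (intro UN_least) (simp add: case_prod_beta)
    then show ?thesis
      unfolding \<epsilon>_def carrier_free_Abelian_group_iff by (rule order_trans[OF keys_frag_extend])
  qed
  then show "\<epsilon> t \<in> carrier ?F'"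
    using t .
  have hom: "group_hom X.free Y.free \<epsilon>"
    unfolding group_hom_def group_hom_axioms_def
    by (intro conjI group_free_Abelian_group homI) (simp_all only: closed, simp add: \<epsilon>_def frag_extend_add)
  interpret F': group Y.free by simp
  have rel: "\<epsilon> ` tensor_rel A N P \<subseteq> tensor_rel A N' P'"
  proof
    fix v assume "v \<in> \<epsilon> ` tensor_rel A N P"
    then obtain u where "u \<in> tensor_rel A N P" and v: "v = \<epsilon> u"
      by blast
    then consider
      (1) x x' y where "u = frag_of (x \<oplus>\<^bsub>N\<^esub> x', y) - frag_of (x, y) - frag_of (x', y)"
        "x \<in> carrier N" "x' \<in> carrier N" "y \<in> carrier P" |
      (2) x y y' where "u = frag_of (x, y \<oplus>\<^bsub>P\<^esub> y') - frag_of (x, y) - frag_of (x, y')"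
        "x \<in> carrier N" "y \<in> carrier P" "y' \<in> carrier P" |
      (3) x a y where "u = frag_of (x \<triangleleft>\<^bsub>N\<^esub> a, y) - frag_of (x, a \<odot>\<^bsub>P\<^esub> y)"
        "x \<in> carrier N" "a \<in> carrier A" "y \<in> carrier P"
      unfolding tensor_rel_def by blast
    then show "v \<in> tensor_rel A N' P'"
    proof cases
      case 1
      then have "v = frag_of (f x \<oplus>\<^bsub>N'\<^esub> f x', g y) - frag_of (f x, g y) - frag_of (f x', g y)"
        by (simp add: v \<epsilon>_def frag_extend_diff additive_add[OF right_linear_additive[OF f]])
      then show ?thesis
        unfolding tensor_rel_def using 1 fN gP by blast
    next
      case 2
      then have "v = frag_of (f x, g y \<oplus>\<^bsub>P'\<^esub> g y') - frag_of (f x, g y) - frag_of (f x, g y')"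
        by (simp add: v \<epsilon>_def frag_extend_diff additive_add[OF left_linear_additive[OF g]])
      then show ?thesis
        unfolding tensor_rel_def using 2 fN gP by blast
    next
      case 3
      then have "v = frag_of (f x \<triangleleft>\<^bsub>N'\<^esub> a, g y) - frag_of (f x, a \<odot>\<^bsub>P'\<^esub> g y)"
        using f g by (simp add: v \<epsilon>_def frag_extend_diff right_linear_def left_linear_def)
      then show ?thesis
        unfolding tensor_rel_def using 3 fN gP by blast
    qed
  qed
  have null: "\<epsilon> ` tensor_null A N P \<subseteq> tensor_null A N' P'"
    unfolding tensor_null_def group_hom.generate_img[OF hom X.tensor_rel_subset, symmetric]
    by (intro F'.mono_generate rel)
  have "tensor_class A N' P' (\<epsilon> s) = tensor_class A N' P' (\<epsilon> t)" if s_in: "s \<in> tensor_class A N P t" for s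
  proof -
    obtain n where n: "n \<in> tensor_null A N P" and s: "s = n + t"
      using s_in by (auto simp: tensor_class_def r_coset_def)
    have nF: "n \<in> carrier X.free"
      using n subgroup.subset[OF X.null_subgroup] by blast
    show ?thesis
    proof (rule Y.class_eqI)
      show "\<epsilon> s \<in> carrier Y.free"
        using nF t keys_add[of n t] by (intro closed) (auto simp: s)
      show "\<epsilon> s - \<epsilon> t \<in> tensor_null A N' P'"
        using n null by (auto simp: s \<epsilon>_def frag_extend_add)
    qed (rule closed[OF t])
  qed
  moreover have "t \<in> tensor_class A N P t"
    unfolding tensor_class_def
    by (rule group.rcos_self[OF group_free_Abelian_group t X.null_subgroup])
  ultimately show "tensor_map A N' P' f g (tensor_class A N P t) = tensor_class A N' P' (\<epsilon> t)"
    unfolding tensor_map_def \<epsilon>_def by blast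
qed

lemma tensor_map_additive:
  assumes "tensor_factors A N P" and "tensor_factors A N' P'"
    and "f \<in> right_linear A N N'" and "g \<in> left_linear A P P'"
  shows "tensor_map A N' P' f g \<in> additive_maps (tensor_product A N P) (tensor_product A N' P')"
proof -
  interpret X: tensor_factors A N P by fact
  interpret Y: tensor_factors A N' P' by fact
  note map = tensor_map_class[OF assms]
  show ?thesis
  proof (rule additive_mapsI)
    fix S assume "S \<in> carrier X.T"
    then show "tensor_map A N' P' f g S \<in> carrier Y.T"
      using map(1) by (auto simp: X.carrier_tensor map(2) intro!: Y.class_closed simp del: carrier_free_Abelian_group_iff)
  next
    fix S S' assume "S \<in> carrier X.T" "S' \<in> carrier X.T"
    then obtain s s' where s: "s \<in> carrier X.free" "s' \<in> carrier X.free"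
      and S: "S = X.cls s" "S' = X.cls s'"
      by (auto simp: X.carrier_tensor)
    have "s + s' \<in> carrier X.free"
      using s keys_add[of s s'] by auto
    then show "tensor_map A N' P' f g (S \<oplus>\<^bsub>X.T\<^esub> S') =
        tensor_map A N' P' f g S \<oplus>\<^bsub>Y.T\<^esub> tensor_map A N' P' f g S'"
      unfolding S X.class_add[OF s, symmetric]
      by (simp only: map(2) s frag_extend_add Y.class_add[OF map(1)[OF s(1)] map(1)[OF s(2)]])
  qed
qed

lemma tensor_map_pure:
  assumes "tensor_factors A N P" and "tensor_factors A N' P'"
    and "f \<in> right_linear A N N'" and "g \<in> left_linear A P P'"
    and "x \<in> carrier N" and "y \<in> carrier P"
  shows "tensor_map A N' P' f g (pure_tensor A N P x y) = pure_tensor A N' P' (f x) (g y)"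
  unfolding pure_tensor_def
  using assms(5,6) by (simp add: tensor_map_class(2)[OF assms(1-4)])

text \<open>Tensoring turns a pair of commutative squares into a commutative square.  Functoriality and the
exchange of maps acting on different factors are special cases, with identities on some edges.\<close>

lemma tensor_map_square:
  assumes "tensor_factors A N P" and "tensor_factors A N\<^sub>1 P\<^sub>1" and "tensor_factors A N\<^sub>2 P\<^sub>2"
    and "tensor_factors A N' P'"
    and f: "f\<^sub>1 \<in> right_linear A N N\<^sub>1" "f\<^sub>1' \<in> right_linear A N\<^sub>1 N'"
      "f\<^sub>2 \<in> right_linear A N N\<^sub>2" "f\<^sub>2' \<in> right_linear A N\<^sub>2 N'"
    and g: "g\<^sub>1 \<in> left_linear A P P\<^sub>1" "g\<^sub>1' \<in> left_linear A P\<^sub>1 P'"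
      "g\<^sub>2 \<in> left_linear A P P\<^sub>2" "g\<^sub>2' \<in> left_linear A P\<^sub>2 P'"
    and "\<And>x. x \<in> carrier N \<Longrightarrow> f\<^sub>1' (f\<^sub>1 x) = f\<^sub>2' (f\<^sub>2 x)"
    and "\<And>y. y \<in> carrier P \<Longrightarrow> g\<^sub>1' (g\<^sub>1 y) = g\<^sub>2' (g\<^sub>2 y)"
    and "t \<in> carrier (tensor_product A N P)"
  shows "tensor_map A N' P' f\<^sub>1' g\<^sub>1' (tensor_map A N\<^sub>1 P\<^sub>1 f\<^sub>1 g\<^sub>1 t) =
    tensor_map A N' P' f\<^sub>2' g\<^sub>2' (tensor_map A N\<^sub>2 P\<^sub>2 f\<^sub>2 g\<^sub>2 t)"
proof -
  interpret X: tensor_factors A N P by fact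
  interpret Y: tensor_factors A N' P' by fact
  note rclosed = right_linear_additive[THEN additive_closed]
    and lclosed = left_linear_additive[THEN additive_closed]
  show ?thesis
    by (rule X.tensor_ext[OF Y.tensor_abelian
        additive_comp[OF tensor_map_additive[OF assms(1,2) f(1) g(1)] tensor_map_additive[OF assms(2,4) f(2) g(2)]]
        additive_comp[OF tensor_map_additive[OF assms(1,3) f(3) g(3)] tensor_map_additive[OF assms(3,4) f(4) g(4)]]
        _ \<open>t \<in> _\<close>])
      (simp add: tensor_map_pure[OF assms(1,2) f(1) g(1)] tensor_map_pure[OF assms(2,4) f(2) g(2)]
        tensor_map_pure[OF assms(1,3) f(3) g(3)] tensor_map_pure[OF assms(3,4) f(4) g(4)]
        rclosed[OF f(1)] rclosed[OF f(3)] lclosed[OF g(1)] lclosed[OF g(3)] assms(13,14))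
qed

lemma tensor_map_id:
  assumes "tensor_factors A N P" and "t \<in> carrier (tensor_product A N P)"
  shows "tensor_map A N P (\<lambda>x. x) (\<lambda>y. y) t = t"
proof -
  interpret X: tensor_factors A N P by fact
  have id: "(\<lambda>t. t) \<in> additive_maps X.T X.T"
    by (simp add: hom_def)
  show ?thesis
    by (rule X.tensor_ext[OF X.tensor_abelian
          tensor_map_additive[OF assms(1,1) id_right_linear id_left_linear] id _ assms(2)])
      (simp add: tensor_map_pure[OF assms(1,1) id_right_linear id_left_linear])
qed

lemma tensor_map_comp:
  assumes "tensor_factors A N P" and "tensor_factors A N\<^sub>1 P\<^sub>1" and "tensor_factors A N' P'"
    and f: "f \<in> right_linear A N N\<^sub>1" "f' \<in> right_linear A N\<^sub>1 N'" "h \<in> right_linear A N N'"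
    and g: "g \<in> left_linear A P P\<^sub>1" "g' \<in> left_linear A P\<^sub>1 P'" "k \<in> left_linear A P P'"
    and "\<And>x. x \<in> carrier N \<Longrightarrow> f' (f x) = h x"
    and "\<And>y. y \<in> carrier P \<Longrightarrow> g' (g y) = k y"
    and "t \<in> carrier (tensor_product A N P)"
  shows "tensor_map A N' P' f' g' (tensor_map A N\<^sub>1 P\<^sub>1 f g t) = tensor_map A N' P' h k t"
  using tensor_map_square[OF assms(1,2,1,3) f(1,2) id_right_linear f(3) g(1,2) id_left_linear g(3) assms(10-12)]
  by (simp add: tensor_map_id assms(1,12))

context two_sided_module
begin

lemma left_mult_right_linear: "b \<in> carrier B \<Longrightarrow> (\<lambda>x. b \<odot>\<^bsub>M\<^esub> x) \<in> right_linear A M M"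
  by (auto simp: right_linear_def hom_def l_closed l_distr_vector commute)

lemma right_mult_left_linear: "a \<in> carrier A \<Longrightarrow> (\<lambda>x. x \<triangleleft>\<^bsub>M\<^esub> a) \<in> left_linear B M M"
  by (auto simp: left_linear_def hom_def r_closed r_distr_vector commute)

end

lemma tensor_smult: "b \<odot>\<^bsub>tensor_product A N P\<^esub> t = tensor_map A N P (\<lambda>x. b \<odot>\<^bsub>N\<^esub> x) (\<lambda>y. y) t"
  by (simp add: tensor_product_def Let_def)

lemma tensor_rsmult: "t \<triangleleft>\<^bsub>tensor_product A N P\<^esub> e = tensor_map A N P (\<lambda>x. x) (\<lambda>y. y \<triangleleft>\<^bsub>P\<^esub> e) t"
  by (simp add: tensor_product_def Let_def)

locale two_sided_factors = N: two_sided_module B A N + P: two_sided_module A E P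
  for B :: "('b, 'h) ring_scheme" and A :: "('a, 'i) ring_scheme" and E :: "('e, 'g) ring_scheme"
    and N :: "('b, 'n, 'a, 'j) bimodule_scheme"
    and P :: "('a, 'p, 'e, 'k) bimodule_scheme"

sublocale two_sided_factors \<subseteq> tensor_factors A N P
  by (rule tensor_factorsI) unfold_locales

context two_sided_factors
begin

lemma smult_additive: "b \<in> carrier B \<Longrightarrow> (\<lambda>t. b \<odot>\<^bsub>T\<^esub> t) \<in> additive_maps T T"
  unfolding tensor_smult
  by (rule tensor_map_additive[OF tensor_factors_axioms tensor_factors_axioms
        N.left_mult_right_linear id_left_linear])

lemma smult_pure:
  "\<lbrakk>b \<in> carrier B; x \<in> carrier N; y \<in> carrier P\<rbrakk> \<Longrightarrow> b \<odot>\<^bsub>T\<^esub> (x \<otimes>\<^sub>t y) = (b \<odot>\<^bsub>N\<^esub> x) \<otimes>\<^sub>t y"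
  unfolding tensor_smult
  by (rule tensor_map_pure[OF tensor_factors_axioms tensor_factors_axioms
        N.left_mult_right_linear id_left_linear])

lemma rsmult_additive: "e \<in> carrier E \<Longrightarrow> (\<lambda>t. t \<triangleleft>\<^bsub>T\<^esub> e) \<in> additive_maps T T"
  unfolding tensor_rsmult
  by (rule tensor_map_additive[OF tensor_factors_axioms tensor_factors_axioms
        id_right_linear P.right_mult_left_linear])

lemma rsmult_pure:
  "\<lbrakk>e \<in> carrier E; x \<in> carrier N; y \<in> carrier P\<rbrakk> \<Longrightarrow> (x \<otimes>\<^sub>t y) \<triangleleft>\<^bsub>T\<^esub> e = x \<otimes>\<^sub>t (y \<triangleleft>\<^bsub>P\<^esub> e)"
  unfolding tensor_rsmult
  by (rule tensor_map_pure[OF tensor_factors_axioms tensor_factors_axioms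
        id_right_linear P.right_mult_left_linear])

lemmas eq_by_pure = tensor_ext[OF tensor_abelian]

text \<open>The outer actions on a tensor product are tensor products of a translation with an identity.  The
module axioms therefore hold because they hold on pure tensors.\<close>

lemma tensor_two_sided: "two_sided_module B E T"
proof -
  interpret T: abelian_group T by (rule tensor_abelian)
  have id: "(\<lambda>t. t) \<in> additive_maps T T"
    by (simp add: hom_def)
  note [simp] = smult_pure rsmult_pure pure_closed N.l_closed P.r_closed
  note smult_comp = additive_comp[OF smult_additive smult_additive]
    and rsmult_comp = additive_comp[OF rsmult_additive rsmult_additive]
  show ?thesis
  proof unfold_locales
    fix b t assume "b \<in> carrier B" "t \<in> carrier T"
    then show "b \<odot>\<^bsub>T\<^esub> t \<in> carrier T"
      by (rule additive_closed[OF smult_additive])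
  next
    fix b b' t assume bt: "b \<in> carrier B" "b' \<in> carrier B" "t \<in> carrier T"
    then show "(b \<oplus>\<^bsub>B\<^esub> b') \<odot>\<^bsub>T\<^esub> t = b \<odot>\<^bsub>T\<^esub> t \<oplus>\<^bsub>T\<^esub> b' \<odot>\<^bsub>T\<^esub> t"
      by - (rule eq_by_pure[OF smult_additive additive_sum[OF tensor_abelian smult_additive smult_additive]],
        simp_all add: N.l_distr_scalar pure_add_left)
  next
    fix b t t' assume "b \<in> carrier B" "t \<in> carrier T" "t' \<in> carrier T"
    then show "b \<odot>\<^bsub>T\<^esub> (t \<oplus>\<^bsub>T\<^esub> t') = b \<odot>\<^bsub>T\<^esub> t \<oplus>\<^bsub>T\<^esub> b \<odot>\<^bsub>T\<^esub> t'"
      by (rule additive_add[OF smult_additive])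
  next
    fix b b' t assume bt: "b \<in> carrier B" "b' \<in> carrier B" "t \<in> carrier T"
    then show "(b \<otimes>\<^bsub>B\<^esub> b') \<odot>\<^bsub>T\<^esub> t = b \<odot>\<^bsub>T\<^esub> (b' \<odot>\<^bsub>T\<^esub> t)"
      by - (rule eq_by_pure[OF smult_additive smult_comp], simp_all add: N.l_assoc)
  next
    fix t assume "t \<in> carrier T"
    then show "\<one>\<^bsub>B\<^esub> \<odot>\<^bsub>T\<^esub> t = t"
      by - (rule eq_by_pure[OF smult_additive id], simp_all add: N.l_unit)
  next
    fix e t assume "e \<in> carrier E" "t \<in> carrier T"
    then show "t \<triangleleft>\<^bsub>T\<^esub> e \<in> carrier T"
      by (rule additive_closed[OF rsmult_additive])
  next
    fix e e' t assume "e \<in> carrier E" "e' \<in> carrier E" "t \<in> carrier T"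
    then show "t \<triangleleft>\<^bsub>T\<^esub> (e \<oplus>\<^bsub>E\<^esub> e') = t \<triangleleft>\<^bsub>T\<^esub> e \<oplus>\<^bsub>T\<^esub> t \<triangleleft>\<^bsub>T\<^esub> e'"
      by - (rule eq_by_pure[OF rsmult_additive additive_sum[OF tensor_abelian rsmult_additive rsmult_additive]],
        simp_all add: P.r_distr_scalar pure_add_right)
  next
    fix e t t' assume "e \<in> carrier E" "t \<in> carrier T" "t' \<in> carrier T"
    then show "(t \<oplus>\<^bsub>T\<^esub> t') \<triangleleft>\<^bsub>T\<^esub> e = t \<triangleleft>\<^bsub>T\<^esub> e \<oplus>\<^bsub>T\<^esub> t' \<triangleleft>\<^bsub>T\<^esub> e"
      by (rule additive_add[OF rsmult_additive])
  next
    fix e e' t assume "e \<in> carrier E" "e' \<in> carrier E" "t \<in> carrier T"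
    then show "t \<triangleleft>\<^bsub>T\<^esub> (e \<otimes>\<^bsub>E\<^esub> e') = t \<triangleleft>\<^bsub>T\<^esub> e \<triangleleft>\<^bsub>T\<^esub> e'"
      by - (rule eq_by_pure[OF rsmult_additive rsmult_comp], simp_all add: P.r_assoc)
  next
    fix t assume "t \<in> carrier T"
    then show "t \<triangleleft>\<^bsub>T\<^esub> \<one>\<^bsub>E\<^esub> = t"
      by - (rule eq_by_pure[OF rsmult_additive id], simp_all add: P.r_unit)
  next
    fix b t e assume "b \<in> carrier B" "t \<in> carrier T" "e \<in> carrier E"
    then show "(b \<odot>\<^bsub>T\<^esub> t) \<triangleleft>\<^bsub>T\<^esub> e = b \<odot>\<^bsub>T\<^esub> (t \<triangleleft>\<^bsub>T\<^esub> e)"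
      by - (rule eq_by_pure[OF additive_comp[OF smult_additive rsmult_additive]
            additive_comp[OF rsmult_additive smult_additive]], simp_all)
  qed
qed

end

lemma two_sided_factorsI:
  "\<lbrakk>two_sided_module B A N; two_sided_module A E P\<rbrakk> \<Longrightarrow> two_sided_factors B A E N P"
  by (simp add: two_sided_factors_def)

text \<open>Only the factor that carries the outer action has to be mapped bilinearly; of the other map, just the
linearity over the inner ring enters, through the balancing.\<close>

lemma tensor_map_left_linear:
  assumes "two_sided_factors B A E N P" and "two_sided_factors B A E' N' P'"
    and f: "f \<in> bilinear B A N N'" and g: "g \<in> left_linear A P P'"
  shows "tensor_map A N' P' f g \<in> left_linear B (tensor_product A N P) (tensor_product A N' P')"
proof -
  interpret X: two_sided_factors B A E N P by fact
  interpret Y: two_sided_factors B A E' N' P' by fact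
  note fr = bilinear_right[OF f]
  have "tensor_map A N' P' f g (b \<odot>\<^bsub>X.T\<^esub> t) = b \<odot>\<^bsub>Y.T\<^esub> tensor_map A N' P' f g t"
    if b: "b \<in> carrier B" and t: "t \<in> carrier X.T" for b t
    unfolding tensor_smult
  proof (rule tensor_map_square[OF X.tensor_factors_axioms X.tensor_factors_axioms
        Y.tensor_factors_axioms Y.tensor_factors_axioms X.N.left_mult_right_linear[OF b] fr fr
        Y.N.left_mult_right_linear[OF b] id_left_linear g g id_left_linear])
    show "f (b \<odot>\<^bsub>N\<^esub> x) = b \<odot>\<^bsub>N'\<^esub> f x" if "x \<in> carrier N" for x
      using f b that by (simp add: bilinear_def left_linear_def)
  qed (simp_all add: t)
  then show ?thesis
    using tensor_map_additive[OF X.tensor_factors_axioms Y.tensor_factors_axioms fr g]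
    by (simp add: left_linear_def)
qed

lemma tensor_map_right_linear:
  assumes "two_sided_factors B A E N P" and "two_sided_factors B' A E N' P'"
    and f: "f \<in> right_linear A N N'" and g: "g \<in> bilinear A E P P'"
  shows "tensor_map A N' P' f g \<in> right_linear E (tensor_product A N P) (tensor_product A N' P')"
proof -
  interpret X: two_sided_factors B A E N P by fact
  interpret Y: two_sided_factors B' A E N' P' by fact
  note gl = bilinear_left[OF g]
  have "tensor_map A N' P' f g (t \<triangleleft>\<^bsub>X.T\<^esub> e) = tensor_map A N' P' f g t \<triangleleft>\<^bsub>Y.T\<^esub> e"
    if e: "e \<in> carrier E" and t: "t \<in> carrier X.T" for e t
    unfolding tensor_rsmult
  proof (rule tensor_map_square[OF X.tensor_factors_axioms X.tensor_factors_axioms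
        Y.tensor_factors_axioms Y.tensor_factors_axioms id_right_linear f f id_right_linear
        X.P.right_mult_left_linear[OF e] gl gl Y.P.right_mult_left_linear[OF e]])
    show "g (y \<triangleleft>\<^bsub>P\<^esub> e) = g y \<triangleleft>\<^bsub>P'\<^esub> e" if "y \<in> carrier P" for y
      using g e that by (simp add: bilinear_def right_linear_def)
  qed (simp_all add: t)
  then show ?thesis
    using tensor_map_additive[OF X.tensor_factors_axioms Y.tensor_factors_axioms f gl]
    by (simp add: right_linear_def)
qed

lemma tensor_map_bilinear:
  assumes "two_sided_factors B A E N P" and "two_sided_factors B A E N' P'"
    and f: "f \<in> bilinear B A N N'" and g: "g \<in> bilinear A E P P'"
  shows "tensor_map A N' P' f g \<in> bilinear B E (tensor_product A N P) (tensor_product A N' P')"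
  using tensor_map_left_linear[OF assms(1,2) f bilinear_left[OF g]]
    tensor_map_right_linear[OF assms(1,2) bilinear_right[OF f] g]
  by (simp add: bilinear_def)


section \<open>Associativity of the tensor product\<close>

locale three_factors =
  N: two_sided_module G B N + P: two_sided_module B A P + Q: two_sided_module A F Q
  for G :: "('g, 'gx) ring_scheme" and B :: "('b, 'bx) ring_scheme"
    and A :: "('a, 'ax) ring_scheme" and F :: "('f, 'fx) ring_scheme"
    and N :: "('g, 'n, 'b, 'nx) bimodule_scheme" and P :: "('b, 'p, 'a, 'px) bimodule_scheme"
    and Q :: "('a, 'q, 'f, 'qx) bimodule_scheme"

sublocale three_factors \<subseteq> NP: two_sided_factors G B A N P
  by unfold_locales

sublocale three_factors \<subseteq> PQ: two_sided_factors B A F P Q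
  by unfold_locales

sublocale three_factors \<subseteq> left: two_sided_factors G A F NP.T Q
  by (intro two_sided_factorsI NP.tensor_two_sided) unfold_locales

sublocale three_factors \<subseteq> right: two_sided_factors G B F N PQ.T
  by (intro two_sided_factorsI PQ.tensor_two_sided) unfold_locales

lemma three_factorsI:
  "\<lbrakk>two_sided_module G B N; two_sided_module B A P; two_sided_module A F Q\<rbrakk>
    \<Longrightarrow> three_factors G B A F N P Q"
  by (simp add: three_factors_def)

context three_factors
begin

text \<open>Triple tensors generate: for fixed \<open>z\<close>, both maps are additive in the left-hand factor \<open>s\<close> of
\<open>s \<otimes> z\<close>, and it is enough to take \<open>s\<close> pure.\<close>

lemma left_ext:
  assumes "abelian_group H" and f: "f \<in> additive_maps left.T H" and g: "g \<in> additive_maps left.T H"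
    and eq: "\<And>x y z. \<lbrakk>x \<in> carrier N; y \<in> carrier P; z \<in> carrier Q\<rbrakk> \<Longrightarrow>
      f (left.pure (NP.pure x y) z) = g (left.pure (NP.pure x y) z)"
    and "t \<in> carrier left.T"
  shows "f t = g t"
proof (rule left.tensor_ext[OF assms(1) f g _ assms(5)])
  fix s z assume s: "s \<in> carrier NP.T" and z: "z \<in> carrier Q"
  have add: "(\<lambda>s. left.pure s z) \<in> additive_maps NP.T left.T"
    using z by (intro additive_mapsI left.pure_closed left.pure_add_left)
  show "f (left.pure s z) = g (left.pure s z)"
    by (rule NP.tensor_ext[OF assms(1) additive_comp[OF add f] additive_comp[OF add g] _ s])
      (rule eq[OF _ _ z])
qed

text \<open>For fixed \<open>z\<close>, tensoring the identity with \<open>y \<mapsto> y \<otimes> z\<close> gives a map \<open>\<phi> z\<close> from \<open>N \<otimes> P\<close> to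
\<open>N \<otimes> (P \<otimes> Q)\<close>.  The assignment \<open>(s, z) \<mapsto> \<phi> z s\<close> is biadditive and balanced, so that the universal
property yields the map on \<open>(N \<otimes> P) \<otimes> Q\<close>.\<close>

lemma tensor_assoc_exists:
  obtains \<alpha> where "\<alpha> \<in> additive_maps left.T right.T"
    and "\<And>x y z. \<lbrakk>x \<in> carrier N; y \<in> carrier P; z \<in> carrier Q\<rbrakk> \<Longrightarrow>
      \<alpha> (left.pure (NP.pure x y) z) = right.pure x (PQ.pure y z)"
proof -
  define \<phi> where "\<phi> z = tensor_map B N PQ.T (\<lambda>x. x) (\<lambda>y. PQ.pure y z)" for z
  have lin: "(\<lambda>y. PQ.pure y z) \<in> left_linear B P PQ.T" if "z \<in> carrier Q" for z
    unfolding left_linear_def using that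
    by (auto intro!: additive_mapsI simp: PQ.pure_closed PQ.pure_add_left PQ.smult_pure)
  note factors = NP.tensor_factors_axioms right.tensor_factors_axioms
  have add: "\<phi> z \<in> additive_maps NP.T right.T" if "z \<in> carrier Q" for z
    unfolding \<phi>_def by (rule tensor_map_additive[OF factors id_right_linear lin[OF that]])
  have pure: "\<phi> z (NP.pure x y) = right.pure x (PQ.pure y z)"
    if "x \<in> carrier N" "y \<in> carrier P" "z \<in> carrier Q" for x y z
    unfolding \<phi>_def by (rule tensor_map_pure[OF factors id_right_linear lin]) (use that in auto)
  obtain \<alpha> where \<alpha>: "\<alpha> \<in> additive_maps left.T right.T"
    and \<alpha>_pure: "\<And>s z. \<lbrakk>s \<in> carrier NP.T; z \<in> carrier Q\<rbrakk> \<Longrightarrow> \<alpha> (left.pure s z) = \<phi> z s"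
  proof (rule left.tensor_universal[OF right.tensor_abelian, of "\<lambda>s z. \<phi> z s"])
    show "\<phi> z s \<in> carrier right.T" if "s \<in> carrier NP.T" "z \<in> carrier Q" for s z
      using additive_closed[OF add] that by blast
    show "\<phi> z (s \<oplus>\<^bsub>NP.T\<^esub> s') = \<phi> z s \<oplus>\<^bsub>right.T\<^esub> \<phi> z s'"
      if "s \<in> carrier NP.T" "s' \<in> carrier NP.T" "z \<in> carrier Q" for s s' z
      using additive_add[OF add] that by blast
    show "\<phi> (z \<oplus>\<^bsub>Q\<^esub> z') s = \<phi> z s \<oplus>\<^bsub>right.T\<^esub> \<phi> z' s"
      if "s \<in> carrier NP.T" "z \<in> carrier Q" "z' \<in> carrier Q" for s z z'
      using that
      by - (rule NP.tensor_ext[OF right.tensor_abelian add additive_sum[OF right.tensor_abelian add add]],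
        simp_all add: pure PQ.pure_add_right right.pure_add_right PQ.pure_closed)
    show "\<phi> z (s \<triangleleft>\<^bsub>NP.T\<^esub> a) = \<phi> (a \<odot>\<^bsub>Q\<^esub> z) s"
      if "s \<in> carrier NP.T" "a \<in> carrier A" "z \<in> carrier Q" for s a z
      using that
      by - (rule NP.tensor_ext[OF right.tensor_abelian additive_comp[OF NP.rsmult_additive add] add],
        simp_all add: pure NP.rsmult_pure PQ.pure_balanced P.r_closed Q.l_closed)
  qed (rule that)
  show thesis
    by (rule that[OF \<alpha>]) (simp add: \<alpha>_pure NP.pure_closed pure)
qed

abbreviation assoc where "assoc \<equiv> tensor_assoc B A N P Q"

lemma assoc:
  "assoc \<in> additive_maps left.T right.T \<and> (\<forall>x\<in>carrier N. \<forall>y\<in>carrier P. \<forall>z\<in>carrier Q.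
    assoc (left.pure (NP.pure x y) z) = right.pure x (PQ.pure y z))"
proof -
  have "\<exists>\<alpha>. \<alpha> \<in> additive_maps left.T right.T \<and> (\<forall>x\<in>carrier N. \<forall>y\<in>carrier P. \<forall>z\<in>carrier Q.
    \<alpha> (left.pure (NP.pure x y) z) = right.pure x (PQ.pure y z))"
    by (rule tensor_assoc_exists) blast
  from someI_ex[OF this] show ?thesis
    unfolding tensor_assoc_def .
qed

lemma assoc_additive: "assoc \<in> additive_maps left.T right.T"
  using assoc by blast

lemma assoc_pure:
  "\<lbrakk>x \<in> carrier N; y \<in> carrier P; z \<in> carrier Q\<rbrakk> \<Longrightarrow>
    assoc (left.pure (NP.pure x y) z) = right.pure x (PQ.pure y z)"
  using assoc by blast

end

text \<open>Both composites send \<open>(x \<otimes> y) \<otimes> z\<close> to \<open>f x \<otimes> (g y \<otimes> h z)\<close>.\<close>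

lemma tensor_assoc_natural:
  assumes "three_factors G B A F N P Q" and "three_factors G B A F N' P' Q'"
    and f: "f \<in> bilinear G B N N'" and g: "g \<in> bilinear B A P P'" and h: "h \<in> bilinear A F Q Q'"
    and t: "t \<in> carrier (tensor_product A (tensor_product B N P) Q)"
  shows "tensor_assoc B A N' P' Q'
      (tensor_map A (tensor_product B N' P') Q' (tensor_map B N' P' f g) h t) =
    tensor_map B N' (tensor_product A P' Q') f (tensor_map A P' Q' g h) (tensor_assoc B A N P Q t)"
proof -
  interpret X: three_factors G B A F N P Q by fact
  interpret Y: three_factors G B A F N' P' Q' by fact
  note fg = tensor_map_bilinear[OF X.NP.two_sided_factors_axioms Y.NP.two_sided_factors_axioms f g]
  note gh = tensor_map_bilinear[OF X.PQ.two_sided_factors_axioms Y.PQ.two_sided_factors_axioms g h]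
  note left = X.left.tensor_factors_axioms Y.left.tensor_factors_axioms
    bilinear_right[OF fg] bilinear_left[OF h]
  note right = X.right.tensor_factors_axioms Y.right.tensor_factors_axioms
    bilinear_right[OF f] bilinear_left[OF gh]
  note closed = bilinear_additive[THEN additive_closed]
  show ?thesis
    by (rule X.left_ext[OF Y.right.tensor_abelian
          additive_comp[OF tensor_map_additive[OF left] Y.assoc_additive]
          additive_comp[OF X.assoc_additive tensor_map_additive[OF right]] _ t])
      (simp add: tensor_map_pure[OF left] tensor_map_pure[OF right] X.assoc_pure Y.assoc_pure
        X.NP.pure_closed X.PQ.pure_closed closed[OF f] closed[OF g] closed[OF h]
        tensor_map_pure[OF X.NP.tensor_factors_axioms Y.NP.tensor_factors_axioms bilinear_right[OF f] bilinear_left[OF g]]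
        tensor_map_pure[OF X.PQ.tensor_factors_axioms Y.PQ.tensor_factors_axioms bilinear_right[OF g] bilinear_left[OF h]])
qed

section \<open>Comodule laws on generators\<close>

lemma bimodule_two_sided: "bimodule R B A M \<Longrightarrow> two_sided_module B A M"
  by (simp add: two_sided_module_def two_sided_module_axioms_def bimodule_def bimodule_axioms_def)

text \<open>Linear maps carry no information outside the carrier, so two representatives that agree there have
the same tensor product with any map.\<close>

lemma tensor_map_cong:
  assumes "tensor_factors A N P" and "tensor_factors A N' P'"
    and "f \<in> right_linear A N N'" and "f' \<in> right_linear A N N'"
    and "g \<in> left_linear A P P'" and "g' \<in> left_linear A P P'"
    and "\<And>x. x \<in> carrier N \<Longrightarrow> f x = f' x" and "\<And>y. y \<in> carrier P \<Longrightarrow> g y = g' y"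
    and "t \<in> carrier (tensor_product A N P)"
  shows "tensor_map A N' P' f g t = tensor_map A N' P' f' g' t"
  using tensor_map_comp[OF assms(1,1,2) id_right_linear assms(3,4) id_left_linear assms(5-9)]
  by (simp add: tensor_map_id assms(1,9))

lemma regular_two_sided:
  assumes "ring A"
  shows "two_sided_module A A (regular_bimodule A)"
proof -
  interpret A: ring A by fact
  interpret M: abelian_group "regular_bimodule A"
    by (rule abelian_groupI) (auto simp: regular_bimodule_def A.a_ac intro: A.l_neg A.a_inv_closed bexI)
  show ?thesis
    by unfold_locales
      (simp_all add: regular_bimodule_def A.l_distr A.r_distr A.m_assoc)
qed

text \<open>A bicomodule without its laws.  The two sides of each law are given names below, as functions of the
element, so that their additivity and naturality can be stated.\<close>

locale coacting_bimodule =
  coring_D: coring R B D + coring_C: coring R A C + bimodule R B A M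
  for R :: "('r, 'i) ring_scheme"
    and B :: "('r, 'b, 'j) module_scheme" and D :: "('b, 'd, 'k) coring_scheme"
    and A :: "('r, 'a, 'l) module_scheme" and C :: "('a, 'c, 'n) coring_scheme"
    and M :: "('b, 'd, 'm, 'a, 'c, 'o) bicomodule_scheme" +
  assumes lcoact_bilinear: "lcoact M \<in> bilinear B A M (tensor_product B D M)"
    and rcoact_bilinear: "rcoact M \<in> bilinear B A M (tensor_product A M C)"
begin

lemma C_module: "two_sided_module A A C"
  by (rule bimodule_two_sided) unfold_locales

lemma D_module: "two_sided_module B B D"
  by (rule bimodule_two_sided) unfold_locales

lemma M_module: "two_sided_module B A M"
  by (rule bimodule_two_sided) unfold_locales

lemma A_module: "two_sided_module A A (regular_bimodule A)"
  by (rule regular_two_sided) unfold_locales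

lemma B_module: "two_sided_module B B (regular_bimodule B)"
  by (rule regular_two_sided) unfold_locales

end

sublocale bicomodule \<subseteq> coacting_bimodule
  by unfold_locales (rule lcoact_bilinear rcoact_bilinear)+

sublocale coacting_bimodule \<subseteq> CC: two_sided_factors A A A C C
  by (rule two_sided_factorsI[OF C_module C_module])

sublocale coacting_bimodule \<subseteq> DD: two_sided_factors B B B D D
  by (rule two_sided_factorsI[OF D_module D_module])

sublocale coacting_bimodule \<subseteq> MC: two_sided_factors B A A M C
  by (rule two_sided_factorsI[OF M_module C_module])

sublocale coacting_bimodule \<subseteq> DM: two_sided_factors B B A D M
  by (rule two_sided_factorsI[OF D_module M_module])

sublocale coacting_bimodule \<subseteq> MA: two_sided_factors B A A M "regular_bimodule A"
  by (rule two_sided_factorsI[OF M_module A_module])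

sublocale coacting_bimodule \<subseteq> BM: two_sided_factors B B A "regular_bimodule B" M
  by (rule two_sided_factorsI[OF B_module M_module])

sublocale coacting_bimodule \<subseteq> MCC: three_factors B A A A M C C
  by (rule three_factorsI[OF M_module C_module C_module])

sublocale coacting_bimodule \<subseteq> DDM: three_factors B B B A D D M
  by (rule three_factorsI[OF D_module D_module M_module])

sublocale coacting_bimodule \<subseteq> DMC: three_factors B B A A D M C
  by (rule three_factorsI[OF D_module M_module C_module])

context coacting_bimodule
begin

lemmas factors = CC.tensor_factors_axioms DD.tensor_factors_axioms MC.tensor_factors_axioms
  DM.tensor_factors_axioms MA.tensor_factors_axioms BM.tensor_factors_axioms
  MCC.left.tensor_factors_axioms MCC.right.tensor_factors_axioms
  DDM.left.tensor_factors_axioms DDM.right.tensor_factors_axioms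
  DMC.left.tensor_factors_axioms DMC.right.tensor_factors_axioms

lemmas linear = id_left_linear id_right_linear
  lcoact_bilinear[THEN bilinear_left] lcoact_bilinear[THEN bilinear_right]
  rcoact_bilinear[THEN bilinear_left] rcoact_bilinear[THEN bilinear_right]
  coring_C.comult_bilinear[THEN bilinear_left] coring_C.comult_bilinear[THEN bilinear_right]
  coring_C.counit_bilinear[THEN bilinear_left] coring_C.counit_bilinear[THEN bilinear_right]
  coring_D.comult_bilinear[THEN bilinear_left] coring_D.comult_bilinear[THEN bilinear_right]
  coring_D.counit_bilinear[THEN bilinear_left] coring_D.counit_bilinear[THEN bilinear_right]

lemmas lcoact_additive = lcoact_bilinear[THEN bilinear_additive]
  and rcoact_additive = rcoact_bilinear[THEN bilinear_additive]

lemmas lcoact_closed = lcoact_additive[THEN additive_closed]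
  and rcoact_closed = rcoact_additive[THEN additive_closed]

definition "left_coassoc_lhs m = tensor_assoc B B D D M
  (tensor_map B (tensor_product B D D) M (comult D) (\<lambda>y. y) (lcoact M m))"

definition "left_coassoc_rhs m =
  tensor_map B D (tensor_product B D M) (\<lambda>x. x) (lcoact M) (lcoact M m)"

definition "left_counit_lhs m =
  tensor_map B (regular_bimodule B) M (counit D) (\<lambda>y. y) (lcoact M m)"

definition "left_counit_rhs m = pure_tensor B (regular_bimodule B) M \<one>\<^bsub>B\<^esub> m"

definition "right_coassoc_lhs m = tensor_assoc A A M C C
  (tensor_map A (tensor_product A M C) C (rcoact M) (\<lambda>y. y) (rcoact M m))"

definition "right_coassoc_rhs m =
  tensor_map A M (tensor_product A C C) (\<lambda>x. x) (comult C) (rcoact M m)"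

definition "right_counit_lhs m =
  tensor_map A M (regular_bimodule A) (\<lambda>x. x) (counit C) (rcoact M m)"

definition "right_counit_rhs m = pure_tensor A M (regular_bimodule A) m \<one>\<^bsub>A\<^esub>"

definition "compatible_lhs m = tensor_assoc B A D M C
  (tensor_map A (tensor_product B D M) C (lcoact M) (\<lambda>y. y) (rcoact M m))"

definition "compatible_rhs m =
  tensor_map B D (tensor_product A M C) (\<lambda>x. x) (rcoact M) (lcoact M m)"

lemmas side_defs = left_coassoc_lhs_def left_coassoc_rhs_def left_counit_lhs_def left_counit_rhs_def
  right_coassoc_lhs_def right_coassoc_rhs_def right_counit_lhs_def right_counit_rhs_def
  compatible_lhs_def compatible_rhs_def

lemma one_regular: "\<one>\<^bsub>A\<^esub> \<in> carrier (regular_bimodule A)" "\<one>\<^bsub>B\<^esub> \<in> carrier (regular_bimodule B)"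
  by (simp_all add: regular_bimodule_def)

lemma left_coassoc_additive:
  "left_coassoc_lhs \<in> additive_maps M DDM.right.T" "left_coassoc_rhs \<in> additive_maps M DDM.right.T"
  unfolding left_coassoc_lhs_def left_coassoc_rhs_def
  by (intro additive_comp[OF lcoact_additive] additive_comp[OF _ DDM.assoc_additive]
      tensor_map_additive factors linear)+

lemma right_coassoc_additive:
  "right_coassoc_lhs \<in> additive_maps M MCC.right.T" "right_coassoc_rhs \<in> additive_maps M MCC.right.T"
  unfolding right_coassoc_lhs_def right_coassoc_rhs_def
  by (intro additive_comp[OF rcoact_additive] additive_comp[OF _ MCC.assoc_additive]
      tensor_map_additive factors linear)+

lemma compatible_additive:
  "compatible_lhs \<in> additive_maps M DMC.right.T" "compatible_rhs \<in> additive_maps M DMC.right.T"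
  unfolding compatible_lhs_def compatible_rhs_def
  by (intro additive_comp[OF rcoact_additive] additive_comp[OF lcoact_additive]
      additive_comp[OF _ DMC.assoc_additive] tensor_map_additive factors linear)+

lemma left_counit_additive:
  "left_counit_lhs \<in> additive_maps M BM.T" "left_counit_rhs \<in> additive_maps M BM.T"
proof -
  show "left_counit_lhs \<in> additive_maps M BM.T"
    unfolding left_counit_lhs_def
    by (intro additive_comp[OF lcoact_additive] tensor_map_additive factors linear)
  show "left_counit_rhs \<in> additive_maps M BM.T"
    unfolding left_counit_rhs_def
    by (intro additive_mapsI BM.pure_closed BM.pure_add_right one_regular)
qed

lemma right_counit_additive:
  "right_counit_lhs \<in> additive_maps M MA.T" "right_counit_rhs \<in> additive_maps M MA.T"
proof -
  show "right_counit_lhs \<in> additive_maps M MA.T"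
    unfolding right_counit_lhs_def
    by (intro additive_comp[OF rcoact_additive] tensor_map_additive factors linear)
  show "right_counit_rhs \<in> additive_maps M MA.T"
    unfolding right_counit_rhs_def
    by (intro additive_mapsI MA.pure_closed MA.pure_add_left one_regular)
qed

end

lemma (in bicomodule) laws:
  assumes "m \<in> carrier M"
  shows "left_coassoc_lhs m = left_coassoc_rhs m" "left_counit_lhs m = left_counit_rhs m"
    "right_coassoc_lhs m = right_coassoc_rhs m" "right_counit_lhs m = right_counit_rhs m"
    "compatible_lhs m = compatible_rhs m"
  using assms left_coassoc left_counit right_coassoc right_counit compatible
  by (simp_all add: side_defs)

lemma (in coacting_bimodule) bicomoduleI:
  assumes "\<And>m. m \<in> carrier M \<Longrightarrow> left_coassoc_lhs m = left_coassoc_rhs m"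
    and "\<And>m. m \<in> carrier M \<Longrightarrow> left_counit_lhs m = left_counit_rhs m"
    and "\<And>m. m \<in> carrier M \<Longrightarrow> right_coassoc_lhs m = right_coassoc_rhs m"
    and "\<And>m. m \<in> carrier M \<Longrightarrow> right_counit_lhs m = right_counit_rhs m"
    and "\<And>m. m \<in> carrier M \<Longrightarrow> compatible_lhs m = compatible_rhs m"
  shows "bicomodule R B D A C M"
  using assms unfolding side_defs
  by unfold_locales (rule lcoact_bilinear rcoact_bilinear, assumption?)+

text \<open>A morphism carries each side of each law in \<open>L\<close> to the corresponding side in \<open>N\<close>.  The proofs move
\<open>f\<close> outwards, first past the coaction, which is the definition of a morphism, then past the remaining
map, which acts on another tensor factor, and for the bracketed sides past the associativity map.\<close>

locale coaction_morphism =
  L: coacting_bimodule R B D A C L + N: coacting_bimodule R B D A C N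
  for R :: "('r, 'i) ring_scheme"
    and B :: "('r, 'b, 'j) module_scheme" and D :: "('b, 'd, 'k) coring_scheme"
    and A :: "('r, 'a, 'l) module_scheme" and C :: "('a, 'c, 'n) coring_scheme"
    and L :: "('b, 'd, 'p, 'a, 'c, 'o) bicomodule_scheme"
    and N :: "('b, 'd, 'q, 'a, 'c, 'o') bicomodule_scheme" +
  fixes f :: "'p \<Rightarrow> 'q"
  assumes f: "f \<in> bicolinear B D A C L N"
begin

lemma f_bilinear: "f \<in> bilinear B A L N"
  using f by (simp add: bicolinear_def)

lemmas f_linear = f_bilinear[THEN bilinear_left] f_bilinear[THEN bilinear_right]

lemma coact_commute:
  assumes "x \<in> carrier L"
  shows "lcoact N (f x) = tensor_map B D N (\<lambda>d. d) f (lcoact L x)"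
    and "rcoact N (f x) = tensor_map A N C f (\<lambda>c. c) (rcoact L x)"
  using f assms by (simp_all add: bicolinear_def)

lemma fC_bilinear: "tensor_map A N C f (\<lambda>c. c) \<in> bilinear B A L.MC.T N.MC.T"
  by (rule tensor_map_bilinear[OF L.MC.two_sided_factors_axioms N.MC.two_sided_factors_axioms
        f_bilinear id_bilinear])

lemma Df_bilinear: "tensor_map B D N (\<lambda>d. d) f \<in> bilinear B A L.DM.T N.DM.T"
  by (rule tensor_map_bilinear[OF L.DM.two_sided_factors_axioms N.DM.two_sided_factors_axioms
        id_bilinear f_bilinear])

lemmas all_linear = L.linear N.linear f_linear fC_bilinear[THEN bilinear_left]
  fC_bilinear[THEN bilinear_right] Df_bilinear[THEN bilinear_left] Df_bilinear[THEN bilinear_right]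

lemma right_coassoc_lhs:
  assumes x: "x \<in> carrier L"
  shows "N.right_coassoc_lhs (f x) = tensor_map A N L.CC.T f (\<lambda>y. y) (L.right_coassoc_lhs x)"
proof -
  let ?u = "tensor_map A L.MC.T C (rcoact L) (\<lambda>y. y) (rcoact L x)"
  have u: "?u \<in> carrier L.MCC.left.T"
    by (rule additive_closed[OF tensor_map_additive L.rcoact_closed[OF x]]) (rule L.factors L.linear)+
  have "tensor_map A N.MC.T C (rcoact N) (\<lambda>y. y) (rcoact N (f x)) =
      tensor_map A N.MC.T C (tensor_map A N C f (\<lambda>c. c)) (\<lambda>y. y) ?u"
    unfolding coact_commute(2)[OF x]
    by (rule tensor_map_square[where N = L and P = C])
      (simp_all add: all_linear L.factors N.factors coact_commute L.rcoact_closed[OF x])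
  also have "tensor_assoc A A N C C \<dots> =
      tensor_map A N L.CC.T f (tensor_map A C C (\<lambda>c. c) (\<lambda>c. c)) (tensor_assoc A A L C C ?u)"
    by (rule tensor_assoc_natural[OF L.MCC.three_factors_axioms N.MCC.three_factors_axioms
          f_bilinear id_bilinear id_bilinear u])
  also have "\<dots> = tensor_map A N L.CC.T f (\<lambda>y. y) (tensor_assoc A A L C C ?u)"
  proof (rule tensor_map_cong[where N = L and P = L.CC.T])
    show "tensor_map A C C (\<lambda>c. c) (\<lambda>c. c) \<in> left_linear A L.CC.T L.CC.T"
      by (rule bilinear_left[OF tensor_map_bilinear[OF L.CC.two_sided_factors_axioms
          L.CC.two_sided_factors_axioms id_bilinear id_bilinear]])
    show "tensor_assoc A A L C C ?u \<in> carrier L.MCC.right.T"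
      by (rule additive_closed[OF L.MCC.assoc_additive u])
  qed (simp_all add: all_linear L.factors N.factors tensor_map_id)
  finally show ?thesis
    by (simp only: L.right_coassoc_lhs_def N.right_coassoc_lhs_def)
qed

lemma right_coassoc_rhs:
  assumes x: "x \<in> carrier L"
  shows "N.right_coassoc_rhs (f x) = tensor_map A N L.CC.T f (\<lambda>y. y) (L.right_coassoc_rhs x)"
  unfolding L.right_coassoc_rhs_def N.right_coassoc_rhs_def coact_commute(2)[OF x]
  by (rule tensor_map_square[where N = L and P = C])
    (simp_all add: all_linear L.factors N.factors L.rcoact_closed[OF x])

lemma right_counit_lhs:
  assumes x: "x \<in> carrier L"
  shows "N.right_counit_lhs (f x) = tensor_map A N (regular_bimodule A) f (\<lambda>y. y) (L.right_counit_lhs x)"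
  unfolding L.right_counit_lhs_def N.right_counit_lhs_def coact_commute(2)[OF x]
  by (rule tensor_map_square[where N = L and P = C])
    (simp_all add: all_linear L.factors N.factors L.rcoact_closed[OF x])

lemma right_counit_rhs:
  assumes x: "x \<in> carrier L"
  shows "N.right_counit_rhs (f x) = tensor_map A N (regular_bimodule A) f (\<lambda>y. y) (L.right_counit_rhs x)"
  unfolding L.right_counit_rhs_def N.right_counit_rhs_def
  by (rule tensor_map_pure[symmetric, where N = L])
    (simp_all add: all_linear L.factors N.factors x L.one_regular)

lemma left_coassoc_lhs:
  assumes x: "x \<in> carrier L"
  shows "N.left_coassoc_lhs (f x) = tensor_map B D N.DM.T (\<lambda>y. y) (tensor_map B D N (\<lambda>d. d) f) (L.left_coassoc_lhs x)"
proof -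
  let ?u = "tensor_map B L.DD.T L (comult D) (\<lambda>y. y) (lcoact L x)"
  have u: "?u \<in> carrier L.DDM.left.T"
    by (rule additive_closed[OF tensor_map_additive L.lcoact_closed[OF x]]) (rule L.factors L.linear)+
  have "tensor_map B L.DD.T N (comult D) (\<lambda>y. y) (lcoact N (f x)) =
      tensor_map B L.DD.T N (tensor_map B D D (\<lambda>d. d) (\<lambda>d. d)) f ?u"
    unfolding coact_commute(1)[OF x]
  proof (rule tensor_map_square[where N = D and P = L])
    show "tensor_map B D D (\<lambda>d. d) (\<lambda>d. d) \<in> right_linear B L.DD.T L.DD.T"
      by (rule bilinear_right[OF tensor_map_bilinear[OF L.DD.two_sided_factors_axioms
          L.DD.two_sided_factors_axioms id_bilinear id_bilinear]])
    show "comult D d = tensor_map B D D (\<lambda>d. d) (\<lambda>d. d) (comult D d)" if "d \<in> carrier D" for d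
      by (rule tensor_map_id[OF L.DD.tensor_factors_axioms, symmetric],
          rule additive_closed[OF bilinear_additive[OF L.coring_D.comult_bilinear] that])
  qed (simp_all add: all_linear L.factors N.factors L.lcoact_closed[OF x])
  also have "tensor_assoc B B D D N \<dots> =
      tensor_map B D N.DM.T (\<lambda>d. d) (tensor_map B D N (\<lambda>d. d) f) (tensor_assoc B B D D L ?u)"
    by (rule tensor_assoc_natural[OF L.DDM.three_factors_axioms N.DDM.three_factors_axioms
          id_bilinear id_bilinear f_bilinear u])
  finally show ?thesis
    by (simp only: L.left_coassoc_lhs_def N.left_coassoc_lhs_def)
qed

lemma left_coassoc_rhs:
  assumes x: "x \<in> carrier L"
  shows "N.left_coassoc_rhs (f x) = tensor_map B D N.DM.T (\<lambda>y. y) (tensor_map B D N (\<lambda>d. d) f) (L.left_coassoc_rhs x)"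
  unfolding L.left_coassoc_rhs_def N.left_coassoc_rhs_def coact_commute(1)[OF x]
  by (rule tensor_map_square[where N = D and P = L])
    (simp_all add: all_linear L.factors N.factors L.lcoact_closed[OF x] coact_commute)

lemma left_counit_lhs:
  assumes x: "x \<in> carrier L"
  shows "N.left_counit_lhs (f x) = tensor_map B (regular_bimodule B) N (\<lambda>y. y) f (L.left_counit_lhs x)"
  unfolding L.left_counit_lhs_def N.left_counit_lhs_def coact_commute(1)[OF x]
  by (rule tensor_map_square[where N = D and P = L])
    (simp_all add: all_linear L.factors N.factors L.lcoact_closed[OF x])

lemma left_counit_rhs:
  assumes x: "x \<in> carrier L"
  shows "N.left_counit_rhs (f x) = tensor_map B (regular_bimodule B) N (\<lambda>y. y) f (L.left_counit_rhs x)"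
  unfolding L.left_counit_rhs_def N.left_counit_rhs_def
  by (rule tensor_map_pure[symmetric, where P = L and f = "\<lambda>y. y"])
    (simp_all add: all_linear L.factors N.factors x L.one_regular)

lemma compatible_lhs:
  assumes x: "x \<in> carrier L"
  shows "N.compatible_lhs (f x) = tensor_map B D N.MC.T (\<lambda>y. y) (tensor_map A N C f (\<lambda>c. c)) (L.compatible_lhs x)"
proof -
  let ?u = "tensor_map A L.DM.T C (lcoact L) (\<lambda>y. y) (rcoact L x)"
  have u: "?u \<in> carrier L.DMC.left.T"
    by (rule additive_closed[OF tensor_map_additive L.rcoact_closed[OF x]]) (rule L.factors L.linear)+
  have "tensor_map A N.DM.T C (lcoact N) (\<lambda>y. y) (rcoact N (f x)) =
      tensor_map A N.DM.T C (tensor_map B D N (\<lambda>d. d) f) (\<lambda>y. y) ?u"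
    unfolding coact_commute(2)[OF x]
    by (rule tensor_map_square[where N = L and P = C])
      (simp_all add: all_linear L.factors N.factors coact_commute L.rcoact_closed[OF x])
  also have "tensor_assoc B A D N C \<dots> =
      tensor_map B D N.MC.T (\<lambda>d. d) (tensor_map A N C f (\<lambda>c. c)) (tensor_assoc B A D L C ?u)"
    by (rule tensor_assoc_natural[OF L.DMC.three_factors_axioms N.DMC.three_factors_axioms
          id_bilinear f_bilinear id_bilinear u])
  finally show ?thesis
    by (simp only: L.compatible_lhs_def N.compatible_lhs_def)
qed

lemma compatible_rhs:
  assumes x: "x \<in> carrier L"
  shows "N.compatible_rhs (f x) = tensor_map B D N.MC.T (\<lambda>y. y) (tensor_map A N C f (\<lambda>c. c)) (L.compatible_rhs x)"
  unfolding L.compatible_rhs_def N.compatible_rhs_def coact_commute(1)[OF x]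
  by (rule tensor_map_square[where N = D and P = L])
    (simp_all add: all_linear L.factors N.factors L.lcoact_closed[OF x] coact_commute)

end

text \<open>Each law equates two additive functions of the element, so it holds everywhere if it holds on
generators, and it holds at \<open>f x\<close> since it is the image under a morphism of the law at \<open>x\<close>.\<close>

lemma (in coacting_bimodule) bicomodule_if_generated:
  assumes "S \<subseteq> carrier M" and gen: "carrier M = generate (add_monoid M) S"
    and cover: "\<And>s. s \<in> S \<Longrightarrow> \<exists>(L :: ('b, 'd, 'm, 'a, 'c, 'o) bicomodule_scheme) f x.
      bicomodule R B D A C L \<and> f \<in> bicolinear B D A C L M \<and> x \<in> carrier L \<and> s = f x"
  shows "bicomodule R B D A C M"
proof -
  have laws: "left_coassoc_lhs s = left_coassoc_rhs s \<and> left_counit_lhs s = left_counit_rhs s \<and>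
    right_coassoc_lhs s = right_coassoc_rhs s \<and> right_counit_lhs s = right_counit_rhs s \<and>
    compatible_lhs s = compatible_rhs s" if "s \<in> S" for s
  proof -
    obtain L :: "('b, 'd, 'm, 'a, 'c, 'o) bicomodule_scheme" and f x
      where L: "bicomodule R B D A C L" and f: "f \<in> bicolinear B D A C L M"
        and x: "x \<in> carrier L" "s = f x"
      using cover[OF \<open>s \<in> S\<close>] by blast
    interpret L: bicomodule R B D A C L by (rule L)
    interpret f: coaction_morphism R B D A C L M f
      by unfold_locales (rule f)
    show ?thesis
      by (simp add: \<open>s = f x\<close> f.left_coassoc_lhs[OF x(1)] f.left_coassoc_rhs[OF x(1)]
          f.left_counit_lhs[OF x(1)] f.left_counit_rhs[OF x(1)] f.right_coassoc_lhs[OF x(1)]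
          f.right_coassoc_rhs[OF x(1)] f.right_counit_lhs[OF x(1)] f.right_counit_rhs[OF x(1)]
          f.compatible_lhs[OF x(1)] f.compatible_rhs[OF x(1)] L.laws[OF x(1)])
  qed
  have "abelian_group M"
    by unfold_locales
  note eq = additive_eq_on_generate[OF this]
  note generated = subsetD[OF equalityD1[OF gen]]
  show ?thesis
  proof (rule bicomoduleI)
    fix m assume "m \<in> carrier M"
    then have m: "m \<in> generate (add_monoid M) S"
      by (rule generated)
    show "left_coassoc_lhs m = left_coassoc_rhs m"
      by (rule eq[OF DDM.right.tensor_abelian left_coassoc_additive assms(1) _ m]) (simp add: laws)
    show "left_counit_lhs m = left_counit_rhs m"
      by (rule eq[OF BM.tensor_abelian left_counit_additive assms(1) _ m]) (simp add: laws)
    show "right_coassoc_lhs m = right_coassoc_rhs m"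
      by (rule eq[OF MCC.right.tensor_abelian right_coassoc_additive assms(1) _ m]) (simp add: laws)
    show "right_counit_lhs m = right_counit_rhs m"
      by (rule eq[OF MA.tensor_abelian right_counit_additive assms(1) _ m]) (simp add: laws)
    show "compatible_lhs m = compatible_rhs m"
      by (rule eq[OF DMC.right.tensor_abelian compatible_additive assms(1) _ m]) (simp add: laws)
  qed
qed

section \<open>Restriction of coactions by flatness\<close>

lemma abelian_group_cong:
  assumes "abelian_group M" and "carrier M' = carrier M" and "add M' = add M" and "zero M' = zero M"
  shows "abelian_group M'"
  using abelian_groupE[OF assms(1)] by (intro abelian_groupI) (simp_all add: assms(2-4))

text \<open>Flatness is stated for test modules whose idle action is by the type \<open>unit\<close>.  The idle
action enters the outer actions of a tensor product, but neither its carrier nor the tensor product of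
maps, so that a second action on a test module can be replaced by a trivial one of that type.\<close>

definition forget_left :: "('b, 'n, 'a, 'x) bimodule_scheme \<Rightarrow> (unit, 'n, 'a) bimodule"
  where "forget_left N = \<lparr>carrier = carrier N, mult = mult N, one = one N, zero = zero N,
    add = add N, smult = (\<lambda>_ x. x), rsmult = rsmult N\<rparr>"

definition forget_right :: "('b, 'n, 'a, 'x) bimodule_scheme \<Rightarrow> ('b, 'n, unit) bimodule"
  where "forget_right N = \<lparr>carrier = carrier N, mult = mult N, one = one N, zero = zero N,
    add = add N, smult = smult N, rsmult = (\<lambda>x _. x)\<rparr>"

lemma forget_left_module:
  assumes "right_module A N"
  shows "right_module A (forget_left N)"
proof -
  interpret N: right_module A N by fact
  interpret abelian_group "forget_left N"
    by (rule abelian_group_cong[OF N.M.abelian_group_axioms]) (simp_all add: forget_left_def)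
  show ?thesis
    by unfold_locales (simp_all add: forget_left_def N.r_closed N.r_distr_scalar N.r_distr_vector
        N.r_assoc N.r_unit)
qed

lemma forget_right_module:
  assumes "left_module B N"
  shows "left_module B (forget_right N)"
proof -
  interpret N: left_module B N by fact
  interpret abelian_group "forget_right N"
    by (rule abelian_group_cong[OF N.M.abelian_group_axioms]) (simp_all add: forget_right_def)
  show ?thesis
    by unfold_locales (simp_all add: forget_right_def N.l_closed N.l_distr_scalar N.l_distr_vector
        N.l_assoc N.l_unit)
qed

lemma inj_tensor_left_flat:
  fixes N' :: "('b, 'n, 'a, 'x) bimodule_scheme" and N :: "('b1, 'n, 'a, 'y) bimodule_scheme"
  assumes flat: "flat_left TYPE('n) A P"
    and N': "right_module A N'" and N: "right_module A N"
    and f: "f \<in> right_linear A N' N" and inj: "inj_on f (carrier N')"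
  shows "inj_on (tensor_map A N P f (\<lambda>y. y)) (carrier (tensor_product A N' P))"
proof -
  have "f \<in> right_linear A (forget_left N') (forget_left N)" "inj_on f (carrier (forget_left N'))"
    using f inj by (simp_all add: forget_left_def right_linear_def hom_def)
  then have "inj_on (tensor_map A (forget_left N) P f (\<lambda>y. y)) (carrier (tensor_product A (forget_left N') P))"
    using flat forget_left_module[OF N'] forget_left_module[OF N] unfolding flat_left_def by blast
  then show ?thesis
    by (simp add: inj_on_def forget_left_def tensor_product_def tensor_map_def tensor_class_def tensor_null_def
        tensor_rel_def Let_def)
qed

lemma inj_tensor_right_flat:
  fixes N' :: "('b, 'n, 'a, 'x) bimodule_scheme" and N :: "('b, 'n, 'a1, 'y) bimodule_scheme"
  assumes flat: "flat_right TYPE('n) B P"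
    and N': "left_module B N'" and N: "left_module B N"
    and f: "f \<in> left_linear B N' N" and inj: "inj_on f (carrier N')"
  shows "inj_on (tensor_map B P N (\<lambda>x. x) f) (carrier (tensor_product B P N'))"
proof -
  have "f \<in> left_linear B (forget_right N') (forget_right N)" "inj_on f (carrier (forget_right N'))"
    using f inj by (simp_all add: forget_right_def left_linear_def hom_def)
  then have "inj_on (tensor_map B P (forget_right N) (\<lambda>x. x) f) (carrier (tensor_product B P (forget_right N')))"
    using flat forget_right_module[OF N'] forget_right_module[OF N] unfolding flat_right_def by blast
  then show ?thesis
    by (simp add: inj_on_def forget_right_def tensor_product_def tensor_map_def tensor_class_def tensor_null_def
        tensor_rel_def Let_def)
qed

text \<open>If the values of \<open>\<rho>\<close> on generators lie in the image of the injective map \<open>\<iota>\<close>, then so do all its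
values, and \<open>\<rho>\<close> factors uniquely through \<open>\<iota>\<close>.  Injectivity also makes the factor bilinear.  With \<open>\<iota>\<close>
the map \<open>N \<otimes> C \<rightarrow> M \<otimes> C\<close> and \<open>\<rho>\<close> the coaction of \<open>M\<close>, the factor is the restricted coaction.\<close>

lemma lift_bilinear:
  assumes N: "two_sided_module B A N" and G: "two_sided_module B A G" and H: "two_sided_module B A H"
    and \<iota>: "\<iota> \<in> bilinear B A G H" and inj: "inj_on \<iota> (carrier G)" and \<rho>: "\<rho> \<in> bilinear B A N H"
    and S: "S \<subseteq> carrier N" and gen: "carrier N \<subseteq> generate (add_monoid N) S"
    and cover: "\<And>s. s \<in> S \<Longrightarrow> \<exists>t\<in>carrier G. \<iota> t = \<rho> s"
  obtains r where "r \<in> bilinear B A N G" and "\<And>x. x \<in> carrier N \<Longrightarrow> \<iota> (r x) = \<rho> x"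
proof -
  interpret N: two_sided_module B A N by fact
  interpret G: two_sided_module B A G by fact
  interpret H: two_sided_module B A H by fact
  have ab: "abelian_group N" "abelian_group G" "abelian_group H"
    by unfold_locales
  note \<iota>a = \<iota>[THEN bilinear_additive] and \<rho>a = \<rho>[THEN bilinear_additive]
  have sub: "subgroup (\<iota> ` carrier G) (add_monoid H)"
    using group_hom.img_is_subgroup[OF additive_group_hom[OF ab(2,3) \<iota>a]] by simp
  have "\<rho> ` S \<subseteq> \<iota> ` carrier G"
    using cover by force
  then have img: "\<rho> x \<in> \<iota> ` carrier G" if "x \<in> carrier N" for x
    using additive_image_generate[OF ab(1,3) \<rho>a sub S] gen that by blast
  define r where "r x = inv_into (carrier G) \<iota> (\<rho> x)" for x
  have r_closed: "r x \<in> carrier G" and r: "\<iota> (r x) = \<rho> x" if "x \<in> carrier N" for x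
    using img[OF that] unfolding r_def by (rule inv_into_into, rule f_inv_into_f)
  have eq: "t = u" if "t \<in> carrier G" "u \<in> carrier G" "\<iota> t = \<iota> u" for t u
    using inj that(3,1,2) by (rule inj_onD)
  have \<iota>_left: "\<iota> (b \<odot>\<^bsub>G\<^esub> t) = b \<odot>\<^bsub>H\<^esub> \<iota> t" if "b \<in> carrier B" "t \<in> carrier G" for b t
    using \<iota> that by (simp add: bilinear_def left_linear_def)
  have \<rho>_left: "\<rho> (b \<odot>\<^bsub>N\<^esub> t) = b \<odot>\<^bsub>H\<^esub> \<rho> t" if "b \<in> carrier B" "t \<in> carrier N" for b t
    using \<rho> that by (simp add: bilinear_def left_linear_def)
  have \<iota>_right: "\<iota> (t \<triangleleft>\<^bsub>G\<^esub> a) = \<iota> t \<triangleleft>\<^bsub>H\<^esub> a" if "a \<in> carrier A" "t \<in> carrier G" for a t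
    using \<iota> that by (simp add: bilinear_def right_linear_def)
  have \<rho>_right: "\<rho> (t \<triangleleft>\<^bsub>N\<^esub> a) = \<rho> t \<triangleleft>\<^bsub>H\<^esub> a" if "a \<in> carrier A" "t \<in> carrier N" for a t
    using \<rho> that by (simp add: bilinear_def right_linear_def)
  have "r \<in> additive_maps N G"
  proof (rule additive_mapsI)
    fix x y assume "x \<in> carrier N" "y \<in> carrier N"
    then show "r (x \<oplus>\<^bsub>N\<^esub> y) = r x \<oplus>\<^bsub>G\<^esub> r y"
      by - (rule eq, simp_all add: abelian_groupE(1)[OF ab(1)] abelian_groupE(1)[OF ab(2)] r_closed r
          additive_add[OF \<iota>a] additive_add[OF \<rho>a])
  qed (rule r_closed)
  moreover have "r (b \<odot>\<^bsub>N\<^esub> x) = b \<odot>\<^bsub>G\<^esub> r x" if "b \<in> carrier B" "x \<in> carrier N" for b x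
    using that by - (rule eq, simp_all add: N.l_closed G.l_closed r_closed r \<iota>_left \<rho>_left)
  moreover have "r (x \<triangleleft>\<^bsub>N\<^esub> a) = r x \<triangleleft>\<^bsub>G\<^esub> a" if "a \<in> carrier A" "x \<in> carrier N" for a x
    using that by - (rule eq, simp_all add: N.r_closed G.r_closed r_closed r \<iota>_right \<rho>_right)
  ultimately have "r \<in> bilinear B A N G"
    by (simp add: bilinear_def left_linear_def right_linear_def)
  then show thesis
    using r by (rule that)
qed

lemma bimodule_restrict:
  fixes M :: "('b, 'd, 'm, 'a, 'c, 'o) bicomodule_scheme"
  assumes M: "bimodule R B A M" and S: "subgroup S (add_monoid M)"
    and left: "\<And>b x. \<lbrakk>b \<in> carrier B; x \<in> S\<rbrakk> \<Longrightarrow> b \<odot>\<^bsub>M\<^esub> x \<in> S"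
    and right: "\<And>a x. \<lbrakk>a \<in> carrier A; x \<in> S\<rbrakk> \<Longrightarrow> x \<triangleleft>\<^bsub>M\<^esub> a \<in> S"
  shows "bimodule R B A (M\<lparr>carrier := S, lcoact := l, rcoact := r\<rparr>)" (is "bimodule R B A ?N")
proof -
  interpret M: bimodule R B A M by fact
  have sub: "x \<in> carrier M" if "x \<in> S" for x
    using subgroup.subset[OF S] that by auto
  have ab: "abelian_group M"
    by unfold_locales
  interpret N: abelian_group ?N
  proof (rule abelian_groupI)
    fix x assume x: "x \<in> carrier ?N"
    then have "\<ominus>\<^bsub>M\<^esub> x \<in> S"
      using subgroup.m_inv_closed[OF S] by (simp add: a_inv_def)
    then show "\<exists>y\<in>carrier ?N. y \<oplus>\<^bsub>?N\<^esub> x = \<zero>\<^bsub>?N\<^esub>"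
      using abelian_group.l_neg[OF ab] sub x by auto
  qed (use subgroup.m_closed[OF S] subgroup.one_closed[OF S] abelian_groupE[OF ab] sub in auto)
  show ?thesis
    using left right sub
    by unfold_locales
      (simp_all add: M.left.l_distr_scalar M.left.l_distr_vector M.left.l_assoc M.left.l_unit
        M.right.r_distr_scalar M.right.r_distr_vector M.right.r_assoc M.right.r_unit
        M.actions_commute M.central)
qed

text \<open>The inclusion of a subbicomodule is linear, so the operations are those of \<open>M\<close>.  Only closure under
negation needs an argument: the inverse within \<open>L\<close> is also an inverse in \<open>M\<close>.\<close>

lemma subbicomodule_subgroup:
  assumes M: "bicomodule R B D A C M" and L: "subbicomodule R B D A C M L"
  shows "subgroup L (add_monoid M)"
    and "\<And>b x. \<lbrakk>b \<in> carrier B; x \<in> L\<rbrakk> \<Longrightarrow> b \<odot>\<^bsub>M\<^esub> x \<in> L"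
    and "\<And>a x. \<lbrakk>a \<in> carrier A; x \<in> L\<rbrakk> \<Longrightarrow> x \<triangleleft>\<^bsub>M\<^esub> a \<in> L"
proof -
  interpret M: bicomodule R B D A C M by fact
  have ab: "abelian_group M"
    by unfold_locales
  obtain l r where "bicomodule R B D A C (M\<lparr>carrier := L, lcoact := l, rcoact := r\<rparr>)"
    using L by (auto simp: subbicomodule_def Let_def)
  then interpret N: bicomodule R B D A C "M\<lparr>carrier := L, lcoact := l, rcoact := r\<rparr>" .
  have abN: "abelian_group (M\<lparr>carrier := L, lcoact := l, rcoact := r\<rparr>)"
    by unfold_locales
  have sub: "L \<subseteq> carrier M"
    using L by (simp add: subbicomodule_def)
  have inv: "\<ominus>\<^bsub>M\<^esub> x \<in> L" if x: "x \<in> L" for x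
  proof -
    obtain y where y: "y \<in> L" "y \<oplus>\<^bsub>M\<^esub> x = \<zero>\<^bsub>M\<^esub>"
      using abelian_groupE(6)[OF abN, of x] x by auto
    then have "\<ominus>\<^bsub>M\<^esub> x = y"
      using abelian_group.minus_equality[OF ab y(2)] sub x by blast
    then show ?thesis
      using y(1) by simp
  qed
  show "subgroup L (add_monoid M)"
    using sub abelian_groupE(1,2)[OF abN] inv
    by (intro subgroup.intro) (auto simp flip: a_inv_def)
  show "b \<odot>\<^bsub>M\<^esub> x \<in> L" if "b \<in> carrier B" "x \<in> L" for b x
    using N.left.l_closed that by simp
  show "x \<triangleleft>\<^bsub>M\<^esub> a \<in> L" if "a \<in> carrier A" "x \<in> L" for a x
    using N.right.r_closed that by simp
qed

text \<open>Tensor products and linearity do not see the coactions, so the coactions of a restriction may be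
exchanged without affecting them.\<close>

lemma restrict_simps:
  fixes M :: "('b, 'd, 'm, 'a, 'c, 'o) bicomodule_scheme"
  shows "tensor_product A (M\<lparr>carrier := S, lcoact := l, rcoact := r\<rparr>) C =
      tensor_product A (M\<lparr>carrier := S\<rparr>) C"
    and "tensor_product B D (M\<lparr>carrier := S, lcoact := l, rcoact := r\<rparr>) =
      tensor_product B D (M\<lparr>carrier := S\<rparr>)"
    and "bilinear B A (M\<lparr>carrier := S, lcoact := l, rcoact := r\<rparr>) G = bilinear B A (M\<lparr>carrier := S\<rparr>) G"
  by (simp_all add: tensor_product_def tensor_map_def tensor_class_def tensor_null_def
      tensor_rel_def Let_def fun_eq_iff bilinear_def left_linear_def right_linear_def)

lemma bilinear_restrict:
  fixes M :: "('b, 'd, 'm, 'a, 'c, 'o) bicomodule_scheme"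
  assumes "\<phi> \<in> bilinear B A M G" and S: "S \<subseteq> carrier M"
  shows "\<phi> \<in> bilinear B A (M\<lparr>carrier := S, lcoact := l, rcoact := r\<rparr>) G"
  using assms(1)
  by (auto simp: bilinear_def left_linear_def right_linear_def hom_def S[THEN subsetD])

text \<open>The coactions of \<open>M\<close> restrict to the sum by flatness and \<open>lift_bilinear\<close>.  The inclusions of the
summands then become morphisms into the sum, again by injectivity after passing to \<open>M\<close>, and
\<open>bicomodule_if_generated\<close> gives the laws.\<close>

lemma subbicomodule_sum:
  fixes M :: "('b, 'd, 'm, 'a, 'c, 'o) bicomodule_scheme"
  assumes M: "bicomodule R B D A C M"
    and flat_C: "flat_left TYPE('m) A C" and flat_D: "flat_right TYPE('m) B D"
    and F: "\<And>L. L \<in> F \<Longrightarrow> subbicomodule R B D A C M L"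
  shows "subbicomodule R B D A C M (generate (add_monoid M) (\<Union>F))"
proof -
  interpret M: bicomodule R B D A C M by fact
  have ab: "abelian_group M"
    by unfold_locales
  note group = abelian_group.a_group[OF ab]
  let ?S = "generate (add_monoid M) (\<Union>F)"
  let ?N = "\<lambda>l r. M\<lparr>carrier := ?S, lcoact := l, rcoact := r\<rparr>"
  note subgr = subbicomodule_subgroup[OF M F]
  have FM: "\<Union>F \<subseteq> carrier M"
    using F by (auto simp: subbicomodule_def)
  have S: "subgroup ?S (add_monoid M)"
    using FM by (intro group.generate_is_subgroup[OF group]) simp
  have SM: "?S \<subseteq> carrier M"
    using subgroup.subset[OF S] by simp
  have incl: "\<Union>F \<subseteq> ?S"
    by (auto intro: generate.incl)
  have left: "b \<odot>\<^bsub>M\<^esub> x \<in> ?S" if b: "b \<in> carrier B" and x: "x \<in> ?S" for b x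
  proof (rule additive_image_generate[OF ab ab _ S FM _ x])
    show "(\<lambda>x. b \<odot>\<^bsub>M\<^esub> x) \<in> additive_maps M M"
      using b by (intro additive_mapsI M.left.l_closed M.left.l_distr_vector)
    show "(\<lambda>x. b \<odot>\<^bsub>M\<^esub> x) ` \<Union>F \<subseteq> ?S"
      using subgr(2)[OF _ b] incl by blast
  qed
  have right: "x \<triangleleft>\<^bsub>M\<^esub> a \<in> ?S" if a: "a \<in> carrier A" and x: "x \<in> ?S" for a x
  proof (rule additive_image_generate[OF ab ab _ S FM _ x])
    show "(\<lambda>x. x \<triangleleft>\<^bsub>M\<^esub> a) \<in> additive_maps M M"
      using a by (intro additive_mapsI M.right.r_closed M.right.r_distr_vector)
    show "(\<lambda>x. x \<triangleleft>\<^bsub>M\<^esub> a) ` \<Union>F \<subseteq> ?S"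
      using subgr(3)[OF _ a] incl by blast
  qed
  have N: "bimodule R B A (?N l r)" for l r
    by (rule bimodule_restrict[OF M.bimodule_axioms S left right])
  have N_module: "two_sided_module B A (?N l r)" for l r
    by (rule bimodule_two_sided[OF N])
  have generated: "?S \<subseteq> generate (add_monoid (?N l r)) (\<Union>F)" for l r
    using group.generate_consistent[OF group incl S] by simp
  have j: "(\<lambda>x. x) \<in> bilinear B A (?N l r) M" for l r
    using SM by (auto simp: bilinear_def left_linear_def right_linear_def hom_def)
  have NC: "two_sided_factors B A A (?N l r) C" for l r
    by (rule two_sided_factorsI[OF N_module M.C_module])
  have DN: "two_sided_factors B B A D (?N l r)" for l r
    by (rule two_sided_factorsI[OF M.D_module N_module])
  let ?\<iota>C = "tensor_map A M C (\<lambda>x. x) (\<lambda>y. y)" and ?\<iota>D = "tensor_map B D M (\<lambda>x. x) (\<lambda>y. y)"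
  have \<iota>C: "?\<iota>C \<in> bilinear B A (tensor_product A (?N l r) C) M.MC.T" for l r
    by (rule tensor_map_bilinear[OF NC M.MC.two_sided_factors_axioms j id_bilinear])
  have \<iota>D: "?\<iota>D \<in> bilinear B A (tensor_product B D (?N l r)) M.DM.T" for l r
    by (rule tensor_map_bilinear[OF DN M.DM.two_sided_factors_axioms id_bilinear j])
  have inj_C: "inj_on ?\<iota>C (carrier (tensor_product A (?N l r) C))" for l r
    using N_module[where l = l and r = r, unfolded two_sided_module_def] M.M_module[unfolded two_sided_module_def]
    by (intro inj_tensor_left_flat[OF flat_C] bilinear_right[OF j]) auto
  have inj_D: "inj_on ?\<iota>D (carrier (tensor_product B D (?N l r)))" for l r
    using N_module[where l = l and r = r, unfolded two_sided_module_def] M.M_module[unfolded two_sided_module_def]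
    by (intro inj_tensor_right_flat[OF flat_D] bilinear_left[OF j]) auto
  \<comment> \<open>Pushing the coaction of a summand forward to the sum gives a preimage of the
    coaction of \<open>M\<close>. The fields \<open>l\<close> and \<open>r\<close> are arbitrary, as this is applied both to construct the
    coactions of the sum and to compare them with those of the summands.\<close>
  have member: "\<exists>l' r'. bicomodule R B D A C (M\<lparr>carrier := L, lcoact := l', rcoact := r'\<rparr>) \<and>
      (\<lambda>x. x) \<in> bilinear B A (M\<lparr>carrier := L, lcoact := l', rcoact := r'\<rparr>) (?N l r) \<and>
      (\<forall>x\<in>L. tensor_map A (?N l r) C (\<lambda>x. x) (\<lambda>y. y) (r' x) \<in> carrier (tensor_product A (?N l r) C) \<and>
        ?\<iota>C (tensor_map A (?N l r) C (\<lambda>x. x) (\<lambda>y. y) (r' x)) = rcoact M x \<and>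
        tensor_map B D (?N l r) (\<lambda>x. x) (\<lambda>y. y) (l' x) \<in> carrier (tensor_product B D (?N l r)) \<and>
        ?\<iota>D (tensor_map B D (?N l r) (\<lambda>x. x) (\<lambda>y. y) (l' x)) = lcoact M x)"
    if "L \<in> F" for L l r
  proof -
    obtain l' r' where L: "bicomodule R B D A C (M\<lparr>carrier := L, lcoact := l', rcoact := r'\<rparr>)"
      and id: "(\<lambda>x. x) \<in> bicolinear B D A C (M\<lparr>carrier := L, lcoact := l', rcoact := r'\<rparr>) M"
      using F[OF \<open>L \<in> F\<close>] by (auto simp: subbicomodule_def Let_def)
    let ?L = "M\<lparr>carrier := L, lcoact := l', rcoact := r'\<rparr>"
    interpret L: bicomodule R B D A C ?L by (rule L)
    have k: "(\<lambda>x. x) \<in> bilinear B A ?L (?N l r)"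
      using incl \<open>L \<in> F\<close> by (auto simp: bilinear_def left_linear_def right_linear_def hom_def)
    interpret NC: two_sided_factors B A A "?N l r" C by (rule NC)
    interpret DN: two_sided_factors B B A D "?N l r" by (rule DN)
    note lin = bilinear_left[OF k] bilinear_right[OF k] bilinear_left[OF j[where l = l and r = r]] bilinear_right[OF j[where l = l and r = r]]
      bilinear_left[OF bicolinear_def[THEN equalityD1, THEN subsetD, OF id, THEN CollectD, THEN conjunct1]]
      bilinear_right[OF bicolinear_def[THEN equalityD1, THEN subsetD, OF id, THEN CollectD, THEN conjunct1]]
    have *: "tensor_map A (?N l r) C (\<lambda>x. x) (\<lambda>y. y) (r' x) \<in> carrier (tensor_product A (?N l r) C)"
      "?\<iota>C (tensor_map A (?N l r) C (\<lambda>x. x) (\<lambda>y. y) (r' x)) = rcoact M x"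
      "tensor_map B D (?N l r) (\<lambda>x. x) (\<lambda>y. y) (l' x) \<in> carrier (tensor_product B D (?N l r))"
      "?\<iota>D (tensor_map B D (?N l r) (\<lambda>x. x) (\<lambda>y. y) (l' x)) = lcoact M x" if x: "x \<in> L" for x
    proof -
      have r': "r' x \<in> carrier L.MC.T" and l': "l' x \<in> carrier L.DM.T"
        using L.rcoact_closed[of x] L.lcoact_closed[of x] x by simp_all
      show "tensor_map A (?N l r) C (\<lambda>x. x) (\<lambda>y. y) (r' x) \<in> carrier (tensor_product A (?N l r) C)"
        by (rule additive_closed[OF tensor_map_additive[OF L.MC.tensor_factors_axioms
                NC.tensor_factors_axioms lin(2) id_left_linear] r'])
      show "tensor_map B D (?N l r) (\<lambda>x. x) (\<lambda>y. y) (l' x) \<in> carrier (tensor_product B D (?N l r))"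
        by (rule additive_closed[OF tensor_map_additive[OF L.DM.tensor_factors_axioms
                DN.tensor_factors_axioms id_right_linear lin(1)] l'])
      have "?\<iota>C (tensor_map A (?N l r) C (\<lambda>x. x) (\<lambda>y. y) (r' x)) = ?\<iota>C (r' x)"
        by (rule tensor_map_comp[OF L.MC.tensor_factors_axioms NC.tensor_factors_axioms
              M.MC.tensor_factors_axioms lin(2) lin(4) lin(6) id_left_linear id_left_linear id_left_linear
              refl refl r'])
      also have "\<dots> = rcoact M x"
        using id x by (simp add: bicolinear_def)
      finally show "?\<iota>C (tensor_map A (?N l r) C (\<lambda>x. x) (\<lambda>y. y) (r' x)) = rcoact M x" .
      have "?\<iota>D (tensor_map B D (?N l r) (\<lambda>x. x) (\<lambda>y. y) (l' x)) = ?\<iota>D (l' x)"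
        by (rule tensor_map_comp[OF L.DM.tensor_factors_axioms DN.tensor_factors_axioms
              M.DM.tensor_factors_axioms id_right_linear id_right_linear id_right_linear lin(1) lin(3) lin(5)
              refl refl l'])
      also have "\<dots> = lcoact M x"
        using id x by (simp add: bicolinear_def)
      finally show "?\<iota>D (tensor_map B D (?N l r) (\<lambda>x. x) (\<lambda>y. y) (l' x)) = lcoact M x" .
    qed
    show ?thesis
      using L k * by blast
  qed
  \<comment> \<open>Tensor products of the sum ignore its coactions, so before these exist the
    coactions of \<open>M\<close> fill the record fields.\<close>
  let ?lM = "lcoact M" and ?rM = "rcoact M"
  let ?U = "?N ?lM ?rM"
  have UC: "two_sided_module B A (tensor_product A ?U C)"
    and DU: "two_sided_module B A (tensor_product B D ?U)"
    by (rule two_sided_factors.tensor_two_sided[OF NC] two_sided_factors.tensor_two_sided[OF DN])+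
  have genU: "carrier ?U \<subseteq> generate (add_monoid ?U) (\<Union>F)" and inclU: "\<Union>F \<subseteq> carrier ?U"
    using generated[where l = ?lM and r = ?rM] incl by simp_all
  have "\<exists>t\<in>carrier (tensor_product A ?U C). ?\<iota>C t = rcoact M s" if "s \<in> \<Union>F" for s
    using member[where l = ?lM and r = ?rM] that by blast
  from lift_bilinear[OF N_module UC M.MC.tensor_two_sided \<iota>C inj_C
      bilinear_restrict[OF M.rcoact_bilinear SM] inclU genU this]
  obtain r where r0: "r \<in> bilinear B A ?U (tensor_product A ?U C)"
    and r': "\<And>x. x \<in> carrier ?U \<Longrightarrow> ?\<iota>C (r x) = rcoact M x"
    by blast
  have "\<exists>t\<in>carrier (tensor_product B D ?U). ?\<iota>D t = lcoact M s" if "s \<in> \<Union>F" for s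
    using member[where l = ?lM and r = ?rM] that by blast
  from lift_bilinear[OF N_module DU M.DM.tensor_two_sided \<iota>D inj_D
      bilinear_restrict[OF M.lcoact_bilinear SM] inclU genU this]
  obtain l where l0: "l \<in> bilinear B A ?U (tensor_product B D ?U)"
    and l': "\<And>x. x \<in> carrier ?U \<Longrightarrow> ?\<iota>D (l x) = lcoact M x"
    by blast
  have r: "?\<iota>C (r x) = rcoact M x" and l: "?\<iota>D (l x) = lcoact M x" if "x \<in> ?S" for x
    using r'[of x] l'[of x] that by simp_all
  interpret N: coacting_bimodule R B D A C "?N l r"
  proof -
    interpret N: bimodule R B A "?N l r" by (rule N)
    show "coacting_bimodule R B D A C (?N l r)"
      using l0 r0 by unfold_locales (simp_all add: restrict_simps)
  qed
  have "bicomodule R B D A C (?N l r)"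
  proof (rule N.bicomodule_if_generated[of "\<Union>F"])
    show "\<Union>F \<subseteq> carrier (?N l r)"
      using incl by simp
    show "carrier (?N l r) = generate (add_monoid (?N l r)) (\<Union>F)"
      using group.generate_consistent[OF group incl S] by simp
    fix s assume "s \<in> \<Union>F"
    then obtain L where "L \<in> F" and s: "s \<in> L"
      by blast
    then obtain l' r' where L: "bicomodule R B D A C (M\<lparr>carrier := L, lcoact := l', rcoact := r'\<rparr>)"
      and k: "(\<lambda>x. x) \<in> bilinear B A (M\<lparr>carrier := L, lcoact := l', rcoact := r'\<rparr>) (?N l r)"
      and C: "\<And>x. x \<in> L \<Longrightarrow> tensor_map A (?N l r) C (\<lambda>x. x) (\<lambda>y. y) (r' x) \<in> carrier N.MC.T"
        "\<And>x. x \<in> L \<Longrightarrow> ?\<iota>C (tensor_map A (?N l r) C (\<lambda>x. x) (\<lambda>y. y) (r' x)) = rcoact M x"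
      and D: "\<And>x. x \<in> L \<Longrightarrow> tensor_map B D (?N l r) (\<lambda>x. x) (\<lambda>y. y) (l' x) \<in> carrier N.DM.T"
        "\<And>x. x \<in> L \<Longrightarrow> ?\<iota>D (tensor_map B D (?N l r) (\<lambda>x. x) (\<lambda>y. y) (l' x)) = lcoact M x"
      using member[OF \<open>L \<in> F\<close>, where l = l and r = r] by blast
    have LS: "x \<in> ?S" if "x \<in> L" for x
      using incl \<open>L \<in> F\<close> that by blast
    \<comment> \<open>Both elements of \<open>N \<otimes> C\<close> have the same image in \<open>M \<otimes> C\<close>.\<close>
    have rx: "tensor_map A (?N l r) C (\<lambda>x. x) (\<lambda>y. y) (r' x) = r x" if "x \<in> L" for x
      using C[OF that] r[OF LS[OF that]] N.rcoact_closed[of x] LS[OF that]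
      by - (rule inj_onD[OF inj_C[where l = l and r = r]], simp_all)
    have lx: "tensor_map B D (?N l r) (\<lambda>x. x) (\<lambda>y. y) (l' x) = l x" if "x \<in> L" for x
      using D[OF that] l[OF LS[OF that]] N.lcoact_closed[of x] LS[OF that]
      by - (rule inj_onD[OF inj_D[where l = l and r = r]], simp_all)
    have "(\<lambda>x. x) \<in> bicolinear B D A C (M\<lparr>carrier := L, lcoact := l', rcoact := r'\<rparr>) (?N l r)"
      using k rx lx by (simp add: bicolinear_def)
    then show "\<exists>(L :: ('b, 'd, 'm, 'a, 'c, 'o) bicomodule_scheme) f x. bicomodule R B D A C L \<and>
        f \<in> bicolinear B D A C L (?N l r) \<and> x \<in> carrier L \<and> s = f x"
      using L s by (intro exI[of _ "M\<lparr>carrier := L, lcoact := l', rcoact := r'\<rparr>"] exI[of _ "\<lambda>x. x"] exI[of _ s]) simp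
  qed
  moreover have "(\<lambda>x. x) \<in> bicolinear B D A C (?N l r) M"
    using j r l by (simp add: bicolinear_def)
  ultimately show ?thesis
    using SM unfolding subbicomodule_def Let_def by blast
qed

section \<open>The spectrum of fully coprime subbicomodules\<close>

locale flat_bicomodule = bicomodule R B D A C M
  for R :: "('r, 'i) ring_scheme"
    and B :: "('r, 'b, 'j) module_scheme" and D :: "('b, 'd, 'k) coring_scheme"
    and A :: "('r, 'a, 'l) module_scheme" and C :: "('a, 'c, 'n) coring_scheme"
    and M :: "('b, 'd, 'm, 'a, 'c, 'o) bicomodule_scheme" +
  assumes flat_C: "flat_left TYPE('m) A C" and flat_D: "flat_right TYPE('m) B D"
begin

abbreviation "invariant \<equiv> fully_invariant R B D A C M"
abbreviation "Spec \<equiv> CPSpec R B D A C M"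
abbreviation "X \<equiv> X_set R B D A C M"
abbreviation "sum_of F \<equiv> generate (add_monoid M) (\<Union>F)"

lemma abelian_group_M: "abelian_group M"
  by unfold_locales

lemma End_additive: "f \<in> carrier (bicomodule_End B D A C M) \<Longrightarrow> f \<in> additive_maps M M"
  by (auto simp: bicomodule_End_def bicolinear_def intro: bilinear_additive)

lemma invariant_subgroup: "invariant L \<Longrightarrow> subgroup L (add_monoid M)"
  using subbicomodule_subgroup(1)[OF bicomodule_axioms] by (simp add: fully_invariant_def)

lemma invariant_subset: "invariant L \<Longrightarrow> L \<subseteq> carrier M"
  by (simp add: fully_invariant_def subbicomodule_def)

lemma invariant_sum:
  assumes F: "\<And>L. L \<in> F \<Longrightarrow> invariant L"
  shows "invariant (sum_of F)"
  unfolding fully_invariant_def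
proof (intro conjI ballI subsetI)
  show sub: "subbicomodule R B D A C M (sum_of F)"
    by (rule subbicomodule_sum[OF bicomodule_axioms flat_C flat_D]) (use F in \<open>simp add: fully_invariant_def\<close>)
  fix f y assume f: "f \<in> carrier (bicomodule_End B D A C M)" and "y \<in> f ` sum_of F"
  then obtain x where x: "x \<in> sum_of F" and y: "y = f x"
    by blast
  show "y \<in> sum_of F"
    unfolding y
  proof (rule additive_image_generate[OF abelian_group_M abelian_group_M End_additive[OF f] _ _ _ x])
    show "subgroup (sum_of F) (add_monoid M)"
      by (rule subbicomodule_subgroup(1)[OF bicomodule_axioms sub])
    show "\<Union>F \<subseteq> carrier M"
      using F invariant_subset by blast
    show "f ` \<Union>F \<subseteq> sum_of F"
      using F f by (fastforce simp: fully_invariant_def intro: generate.incl)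
  qed
qed

lemma sum_of_upper: "L \<in> F \<Longrightarrow> L \<subseteq> sum_of F"
  by (auto intro: generate.incl)

lemma sum_of_least:
  assumes "invariant L" and "\<And>N. N \<in> F \<Longrightarrow> N \<subseteq> L"
  shows "sum_of F \<subseteq> L"
  using assms invariant_subgroup
  by (intro group.generate_subgroup_incl[OF abelian_group.a_group[OF abelian_group_M]]) auto

lemma Spec_invariant: "K \<in> Spec \<Longrightarrow> invariant K"
  by (simp add: CPSpec_def fully_coprime_def)

text \<open>An endomorphism that kills \<open>L\<close> sends \<open>l + n\<close> to the image of \<open>n\<close>, which lies in the invariant \<open>N\<close>.\<close>

lemma sum_subset_colon:
  assumes L: "invariant L" and N: "invariant N"
  shows "sum_of {L, N} \<subseteq> colon B D A C M L N"
  unfolding colon_def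
proof (intro INF_greatest subsetI)
  fix f x assume "f \<in> An B D A C M L" and x: "x \<in> sum_of {L, N}"
  then have f: "f \<in> carrier (bicomodule_End B D A C M)" and fL: "f ` L \<subseteq> {\<zero>\<^bsub>M\<^esub>}"
    by (auto simp: An_def)
  have sub: "\<Union>{L, N} \<subseteq> carrier M"
    using L N invariant_subset by auto
  have "f ` N \<subseteq> N" "\<zero>\<^bsub>M\<^esub> \<in> N"
    using N f subgroup.one_closed[OF invariant_subgroup[OF N]] by (simp_all add: fully_invariant_def)
  then have "f ` \<Union>{L, N} \<subseteq> N"
    using fL by (auto simp: image_Un)
  then have "f x \<in> N"
    by (rule additive_image_generate[OF abelian_group_M abelian_group_M End_additive[OF f]
          invariant_subgroup[OF N] sub _ x])
  moreover have "x \<in> carrier M"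
    using group.generate_in_carrier[OF abelian_group.a_group[OF abelian_group_M] _ x] sub by simp
  ultimately show "x \<in> f -` N \<inter> carrier M"
    by simp
qed

text \<open>Although \<open>(L : N)\<close> may be larger than \<open>L + N\<close>, a fully coprime subbicomodule does not distinguish
between them, so that no coactions on \<open>(L : N)\<close> are required.\<close>

lemma Spec_subset_sum_iff:
  assumes K: "K \<in> Spec" and L: "invariant L" and N: "invariant N"
  shows "K \<subseteq> sum_of {L, N} \<longleftrightarrow> K \<subseteq> L \<or> K \<subseteq> N"
proof
  assume "K \<subseteq> sum_of {L, N}"
  then have "K \<subseteq> colon B D A C M L N"
    using sum_subset_colon[OF L N] by (rule order_trans)
  then show "K \<subseteq> L \<or> K \<subseteq> N"
    using K L N by (simp add: CPSpec_def fully_coprime_def)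
qed (use sum_of_upper[of _ "{L, N}"] in blast)

lemma V_set_sum:
  assumes "invariant L" and "invariant N"
  shows "V_set R B D A C M (sum_of {L, N}) = V_set R B D A C M L \<union> V_set R B D A C M N"
  using Spec_subset_sum_iff[OF _ assms] by (auto simp: V_set_def)

lemma X_set_sum:
  assumes "invariant L" and "invariant N"
  shows "X (sum_of {L, N}) = X L \<inter> X N"
  using Spec_subset_sum_iff[OF _ assms] by (auto simp: X_set_def)

text \<open>A fully coprime subbicomodule below all \<open>L \<in> I\<close> is one of the summands.  This replaces the
intersection of \<open>I\<close>, which need not be a subbicomodule.\<close>

lemma X_set_Union:
  assumes "\<And>L. L \<in> I \<Longrightarrow> invariant L"
  shows "X (sum_of {N. invariant N \<and> (\<forall>L\<in>I. N \<subseteq> L)}) = (\<Union>L\<in>I. X L)" (is "X ?S = _")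
proof -
  have "K \<subseteq> ?S \<longleftrightarrow> (\<forall>L\<in>I. K \<subseteq> L)" if "K \<in> Spec" for K
  proof
    assume "K \<subseteq> ?S"
    moreover have "?S \<subseteq> L" if "L \<in> I" for L
      using that assms by (intro sum_of_least) auto
    ultimately show "\<forall>L\<in>I. K \<subseteq> L"
      by blast
  next
    assume "\<forall>L\<in>I. K \<subseteq> L"
    then show "K \<subseteq> ?S"
      using Spec_invariant[OF that] by (intro sum_of_upper) simp
  qed
  then show ?thesis
    by (auto simp: X_set_def)
qed

lemma not_Spec_subset_zero:
  assumes "K \<in> Spec"
  shows "\<not> K \<subseteq> sum_of {}"
proof
  assume "K \<subseteq> sum_of {}"
  then have "K \<subseteq> {\<zero>\<^bsub>M\<^esub>}"
    using group.generate_empty[OF abelian_group.a_group[OF abelian_group_M]] by simp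
  moreover have "\<zero>\<^bsub>M\<^esub> \<in> K"
    using subgroup.one_closed[OF invariant_subgroup[OF Spec_invariant[OF assms]]] by simp
  ultimately show False
    using assms by (auto simp: CPSpec_def fully_coprime_def)
qed

lemma invariant_zero: "invariant (sum_of {})"
  by (rule invariant_sum) simp

theorem tau_fi_topology: "is_topology_on Spec (tau_fi R B D A C M)"
proof -
  let ?\<tau> = "tau_fi R B D A C M"
  have top: "istopology (\<lambda>U. U \<in> ?\<tau>)"
    unfolding istopology_def
  proof (intro conjI allI impI)
    fix U V assume "U \<in> ?\<tau>" "V \<in> ?\<tau>"
    then obtain L N where "invariant L" "invariant N" "U = X L" "V = X N"
      by (auto simp: tau_fi_def)
    moreover from this have "invariant (sum_of {L, N})"
      by (intro invariant_sum) auto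
    ultimately show "U \<inter> V \<in> ?\<tau>"
      unfolding tau_fi_def by (auto simp flip: X_set_sum)
  next
    fix \<U> assume "\<forall>U\<in>\<U>. U \<in> ?\<tau>"
    \<comment> \<open>All invariant representatives of members of the family are taken, which avoids a choice.\<close>
    define I where "I = {L. invariant L \<and> X L \<in> \<U>}"
    have "\<Union>\<U> = (\<Union>L\<in>I. X L)"
      using \<open>\<forall>U\<in>\<U>. U \<in> ?\<tau>\<close> by (force simp: I_def tau_fi_def)
    also have "\<dots> = X (sum_of {N. invariant N \<and> (\<forall>L\<in>I. N \<subseteq> L)})"
      by (rule X_set_Union[symmetric]) (simp add: I_def)
    also have "\<dots> \<in> ?\<tau>"
      unfolding tau_fi_def by (intro imageI CollectI invariant_sum) simp
    finally show "\<Union>\<U> \<in> ?\<tau>" .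
  qed
  have "Spec = X (sum_of {})"
    using not_Spec_subset_zero by (auto simp: X_set_def)
  then have "Spec \<in> ?\<tau>"
    unfolding tau_fi_def using invariant_zero by blast
  moreover have "\<Union>?\<tau> \<subseteq> Spec"
    by (auto simp: tau_fi_def X_set_def)
  moreover have "topspace (topology (\<lambda>U. U \<in> ?\<tau>)) = \<Union>?\<tau>"
    by (simp add: topspace_def topology_inverse'[OF top])
  ultimately show ?thesis
    using top unfolding is_topology_on_def by blast
qed

lemma duo_tau: "duo R B D A C M \<Longrightarrow> tau R B D A C M = tau_fi R B D A C M"
  by (auto simp: duo_def tau_def tau_fi_def fully_invariant_def)

theorem duo_top_bicomodule:
  assumes duo: "duo R B D A C M"
  shows "top_bicomodule R B D A C M"
proof -
  have xi: "xi R B D A C M = V_set R B D A C M ` Collect invariant"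
    using duo by (auto simp: duo_def xi_def fully_invariant_def)
  have "\<Union>F \<in> xi R B D A C M" if "finite F" "F \<subseteq> xi R B D A C M" for F
    using that
  proof (induction F rule: finite_induct)
    case empty
    have "V_set R B D A C M (sum_of {}) = {}"
      using not_Spec_subset_zero by (auto simp: V_set_def)
    then show ?case
      unfolding xi using invariant_zero by (metis Union_empty imageI mem_Collect_eq)
  next
    case (insert V F)
    then obtain L N where LN: "invariant L" "invariant N"
      "V = V_set R B D A C M L" "\<Union>F = V_set R B D A C M N"
      unfolding xi by auto
    have "\<Union>(insert V F) = V \<union> \<Union>F"
      by (rule Union_insert)
    also have "\<dots> = V_set R B D A C M (sum_of {L, N})"
      by (simp only: LN(3,4) V_set_sum[OF LN(1,2)])
    finally have "\<Union>(insert V F) = V_set R B D A C M (sum_of {L, N})" .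
    moreover have "invariant (sum_of {L, N})"
      using LN by (intro invariant_sum) auto
    ultimately show ?case
      unfolding xi by blast
  qed
  then show ?thesis
    by (simp add: top_bicomodule_def)
qed

end

theorem theorem3p4:
  fixes R :: "'r ring"
    and A :: "('r, 'a) module" and B :: "('r, 'b) module"
    and C :: "('a, 'c) coring" and D :: "('b, 'd) coring"
    and M :: "('b, 'd, 'm, 'a, 'c) bicomodule"
  assumes "cring R" and "\<one>\<^bsub>R\<^esub> \<noteq> \<zero>\<^bsub>R\<^esub>"
    and "unital_algebra R A" and "unital_algebra R B"
    and "coring R A C" and "carrier C \<noteq> {\<zero>\<^bsub>C\<^esub>}"
    and "flat_left TYPE('a) A C" and "flat_left TYPE('m) A C"
    and "flat_left TYPE(('m, 'c) tensor) A C" and "flat_left TYPE(('d, 'm) tensor) A C"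
    and "coring R B D" and "carrier D \<noteq> {\<zero>\<^bsub>D\<^esub>}"
    and "flat_right TYPE('b) B D" and "flat_right TYPE('m) B D"
    and "flat_right TYPE(('m, 'c) tensor) B D" and "flat_right TYPE(('d, 'm) tensor) B D"
    and "bicomodule R B D A C M" and "carrier M \<noteq> {\<zero>\<^bsub>M\<^esub>}"
  shows "is_topology_on (CPSpec R B D A C M) (tau_fi R B D A C M) \<and>
    (duo R B D A C M \<longrightarrow>
      top_bicomodule R B D A C M \<and> is_topology_on (CPSpec R B D A C M) (tau R B D A C M))"
proof -
  interpret flat_bicomodule R B D A C M
    using assms by (simp add: flat_bicomodule_def flat_bicomodule_axioms_def)
  show ?thesis
    using tau_fi_topology duo_top_bicomodule by (auto simp: duo_tau)
qed

end
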